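(* Let $a\in\{2,3,4,6\}$, and let $n>5a^2$ be an integer prime to $a$. Put $D_a=\{d\ge2\mid d\text{ divides }a-1\text{ or }a+1\}$ and $C_{a,n}=\prod_{d\in D_a,\,d\mid n}\Phi_d$. Then \[ \mathcal{S}_{a/n}(q)=C_{a,n}(q)\,E_{a,n}(q), \] where $E_{a,n}(q)\in\mathbb{Z}[q]$ is irreducible over $\mathbb{Q}$ and no root of $E_{a,n}(q)$ is a root of unity. Moreover $E_{a,n}(1)=n/C_{a,n}(1)\ge 2$.
   Context: $q$-deformed rationals: every irreducible fraction $r/s>1$ has a unique Hirzebruch--Jung expansion $r/s=[\![c_1,\dots,c_k]\!]=c_1-\cfrac{1}{c_2-\cfrac{1}{\ddots-\cfrac{1}{c_k}}}$ with all $c_i\ge 2$ integers. Put $R_q=\begin{pmatrix}q&1\\0&1\end{pmatrix}$, $S_q=\begin{pmatrix}0&-q^{-1}\\1&0\end{pmatrix}$ and $M_q(c_1,\dots,c_k)=R_q^{c_1}S_q\cdots R_q^{c_k}S_q$. For $r/s=[\![c_1,\dots,c_k]\!]>1$, the polynomials $\mathcal{R}_{r/s}(q),\mathcal{S}_{r/s}(q)\in\mathbb{Z}[q]$ are the upper and lower entries of the first column of $M_q(c_1,\dots,c_k)$, and $[r/s]_q=\mathcal{R}_{r/s}(q)/\mathcal{S}_{r/s}(q)$. This is extended to $\mathbb{Q}\cup\{\infty\}$ by $[\alpha+1]_q=q[\alpha]_q+1$, $[0/1]_q=0$, $[1/0]_q=1/0$. For an arbitrary irreducible fraction $r/s$ with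 $s>0$, $\mathcal{R}_{r/s}(q)$ and $\mathcal{S}_{r/s}(q)$ are the coprime Laurent polynomials with integer coefficients such that $[r/s]_q=\mathcal{R}_{r/s}(q)/\mathcal{S}_{r/s}(q)$, $\mathcal{S}_{r/s}(q)\in\mathbb{Z}[q]$ and $\mathcal{S}_{r/s}(0)=1$. $\Phi_d(q)$ is the $d$-th cyclotomic polynomial. *)

theory Defs
  imports
    Complex_Main
    "HOL-Computational_Algebra.Computational_Algebra"
    "Jordan_Normal_Form.Matrix"
begin

text \<open>
  All \<open>q\<close>-deformations live in the fraction field \<open>int poly fract\<close> of the polynomial ring over the
  integers in the indeterminate \<open>q\<close>, that is, in the field of rational functions over the rationals.
\<close>

abbreviation qvar :: "int poly fract" where
  "qvar \<equiv> to_fract (monom 1 1)"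

definition R_mat :: "int poly fract mat" where
  "R_mat = mat_of_rows_list 2 [[qvar, 1], [0, 1]]"

definition S_mat :: "int poly fract mat" where
  "S_mat = mat_of_rows_list 2 [[0, - inverse qvar], [1, 0]]"

fun M_mat :: "nat list \<Rightarrow> int poly fract mat" where
  "M_mat [] = 1\<^sub>m 2"
| "M_mat (c # cs) = (R_mat ^\<^sub>m c) * S_mat * M_mat cs"

fun hj_value :: "nat list \<Rightarrow> rat" where
  "hj_value [c] = of_nat c"
| "hj_value (c # d # cs) = of_nat c - 1 / hj_value (d # cs)"

text \<open>Only meaningful for \<open>x > 1\<close>, where exactly one such list exists.\<close>

definition hj_expansion :: "rat \<Rightarrow> nat list" where
  "hj_expansion x = (THE cs. cs \<noteq> [] \<and> (\<forall>c\<in>set cs. 2 \<le> c) \<and> hj_value cs = x)"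

text \<open>
  Every rational number is moved beyond \<open>1\<close> by finitely many unit translations, so the rule
  \<open>[x + 1] = q [x] + 1\<close>, solved for \<open>[x]\<close>, determines the extension to all rationals (in particular
  \<open>[0] = 0\<close>). The value \<open>1/0\<close> at infinity is never reached from a rational number, so it is not
  represented.
\<close>

function q_rational :: "rat \<Rightarrow> int poly fract" where
  "q_rational x =
     (if x > 1
      then (let M = M_mat (hj_expansion x) in M $$ (0, 0) / M $$ (1, 0))
      else (q_rational (x + 1) - 1) / qvar)"
  by pat_completeness auto
termination
  by (relation "measure (\<lambda>x. nat \<lceil>2 - x\<rceil>)") (auto, linarith)

declare q_rational.simps [simp del]

definition laurent_polys :: "int poly fract set" where
  "laurent_polys = {to_fract p / qvar ^ k | p k. True}"

definition laurent_dvd :: "int poly fract \<Rightarrow> int poly fract \<Rightarrow> bool" where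
  "laurent_dvd f g \<longleftrightarrow> (\<exists>h\<in>laurent_polys. g = f * h)"

definition laurent_coprime :: "int poly fract \<Rightarrow> int poly fract \<Rightarrow> bool" where
  "laurent_coprime f g \<longleftrightarrow>
     (\<forall>h\<in>laurent_polys. laurent_dvd h f \<longrightarrow> laurent_dvd h g \<longrightarrow> laurent_dvd h 1)"

text \<open>
  The numerator and denominator of the \<open>q\<close>-rational at \<open>x\<close>; the normalisation of the denominator
  fixes the pair uniquely, the units of the Laurent ring being \<open>\<plusminus> q\<^sup>k\<close>.
\<close>

definition q_fraction :: "rat \<Rightarrow> int poly fract \<Rightarrow> int poly \<Rightarrow> bool" where
  "q_fraction x R S \<longleftrightarrow>
     R \<in> laurent_polys \<and> laurent_coprime R (to_fract S) \<and>
     q_rational x = R / to_fract S \<and> poly S 0 = 1"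

definition q_denominator :: "rat \<Rightarrow> int poly" where
  "q_denominator x = (THE S. \<exists>R. q_fraction x R S)"

definition cyclotomic :: "nat \<Rightarrow> int poly" where
  "cyclotomic d = (THE p. map_poly of_int p =
     (\<Prod>k | 1 \<le> k \<and> k \<le> d \<and> coprime k d. [:- cis (2 * pi * real k / real d), 1:]))"

definition D_set :: "nat \<Rightarrow> nat set" where
  "D_set a = {d. 2 \<le> d \<and> (d dvd a - 1 \<or> d dvd a + 1)}"

definition C_poly :: "nat \<Rightarrow> nat \<Rightarrow> int poly" where
  "C_poly a n = (\<Prod>d | d \<in> D_set a \<and> d dvd n. cyclotomic d)"

end

theory Submission
  imports Defs "Jordan_Normal_Form.Char_Poly" "HOL-Library.Real_Mod"
begin

hide_const (open) Module.smult

text \<open>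
  Write \<open>n = a m + b\<close>; for the given \<open>a\<close> coprimality forces \<open>b = 1\<close> or \<open>b = a - 1\<close>, and with
  \<open>[k] = 1 + q + \<dots> + q^(k-1)\<close> the denominator is \<open>S = [b] + q [a] [m]\<close>. Hence \<open>F = (q - 1)^2 S\<close> has only
  six terms, all with coefficients \<open>\<plusminus>1\<close>, located near the two ends of the exponent range.

  By Ljunggren's method, a factorisation \<open>E = G G'\<close> turns into a polynomial \<open>H = (q - 1)^2 C G G'*\<close>
  with \<open>H H* = F F*\<close>, where \<open>*\<close> is reflection. The middle coefficient shows that \<open>H\<close> also has few
  terms, and the low coefficients of \<open>H\<close> and \<open>H*\<close> solve a convolution equation with a small budget of
  nonzero terms. A finite search leaves only \<open>H = \<plusminus>F\<close> and \<open>H = \<plusminus>F*\<close>, so \<open>G\<close> or \<open>G'\<close> is reciprocal up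
  to sign and \<open>E\<close> has a pair of roots \<open>z\<close>, \<open>1/z\<close>. Eliminating \<open>z^m\<close> from \<open>S(z) = S(1/z) = 0\<close> gives
  \<open>z^(a-1) = 1\<close> or \<open>z^(a+1) = 1\<close>. Such a \<open>z \<noteq> 1\<close> is a root of \<open>S\<close> exactly when \<open>z^n = 1\<close>, and then it
  is a simple root, already accounted for by \<open>C\<close>.
\<close>

section \<open>Polynomials supported near both ends\<close>

text \<open>The list \<open>hi\<close> runs downwards from degree \<open>N\<close>, so that
  reflection merely exchanges the two lists.\<close>

definition two_ended :: "nat \<Rightarrow> int list \<Rightarrow> int list \<Rightarrow> int poly" where
  "two_ended N lo hi = Poly lo + monom 1 (Suc N - length hi) * Poly (rev hi)"

lemma coeff_two_ended:
  assumes "length lo + length hi \<le> Suc N"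
  shows "coeff (two_ended N lo hi) i =
    (if i < length lo then lo ! i
     else if Suc N - length hi \<le> i \<and> i \<le> N then hi ! (N - i) else 0)"
  using assms
  by (auto simp: two_ended_def coeff_monom_mult nth_default_def rev_nth intro!: arg_cong[of _ _ "\<lambda>k. hi ! k"])

lemma degree_two_ended:
  assumes "length lo + length hi \<le> Suc N" "hi \<noteq> []" "hd hi \<noteq> 0"
  shows "degree (two_ended N lo hi) = N"
proof (rule antisym)
  show "degree (two_ended N lo hi) \<le> N"
    using assms by (intro degree_le) (auto simp: coeff_two_ended)
  show "N \<le> degree (two_ended N lo hi)"
    using assms by (intro le_degree) (auto simp: coeff_two_ended hd_conv_nth neq_Nil_conv)
qed

lemma reflect_two_ended:
  assumes "length lo + length hi \<le> Suc N" "lo \<noteq> []" "hd lo \<noteq> 0" "hi \<noteq> []" "hd hi \<noteq> 0"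
  shows "reflect_poly (two_ended N lo hi) = two_ended N hi lo"
  using assms degree_two_ended[OF assms(1,4,5)]
  by (intro poly_eqI) (auto simp: coeff_reflect_poly coeff_two_ended)

text \<open>The sum of squared coefficients is thus determined by the product of a polynomial with
  its reflection. It serves as the budget of the search.\<close>

lemma coeff_mult_reflect_poly_degree:
  fixes p :: "int poly"
  shows "coeff (p * reflect_poly p) (degree p) = (\<Sum>i\<le>degree p. (coeff p i)\<^sup>2)"
  by (auto simp: coeff_mult coeff_reflect_poly power2_eq_square intro!: sum.cong)

lemma sum_coeff_ends:
  fixes p :: "int poly"
  assumes "2 * K \<le> Suc N"
  shows "(\<Sum>i\<le>N. (coeff p i)\<^sup>2) = (\<Sum>i<K. (coeff p i)\<^sup>2) + (\<Sum>i<K. (coeff p (N - i))\<^sup>2)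
           + (\<Sum>i\<in>{K..<Suc N - K}. (coeff p i)\<^sup>2)"
proof -
  have "(\<Sum>i\<in>{Suc N - K..<Suc N}. (coeff p i)\<^sup>2) = (\<Sum>i<K. (coeff p (N - i))\<^sup>2)"
    by (rule sum.reindex_bij_witness[of _ "\<lambda>i. N - i" "\<lambda>i. N - i"]) (use assms in auto)
  moreover have "{..N} = {..<K} \<union> ({K..<Suc N - K} \<union> {Suc N - K..<Suc N})"
    using assms by auto
  ultimately show ?thesis
    using assms by (simp add: sum.union_disjoint ivl_disj_int_one flip: atLeast0LessThan)
      (subst sum.union_disjoint, auto simp: sum.union_disjoint)
qed

lemma energy_two_ended:
  assumes "length lo = K" "length hi = K" "2 * K \<le> Suc N"
  shows "(\<Sum>i\<le>N. (coeff (two_ended N lo hi) i)\<^sup>2) = (\<Sum>x\<leftarrow>lo. x\<^sup>2) + (\<Sum>x\<leftarrow>hi. x\<^sup>2)"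
  using assms unfolding sum_coeff_ends[OF assms(3)]
  by (auto simp: coeff_two_ended sum_list_sum_nth atLeast0LessThan intro!: arg_cong2[of _ _ _ _ "(+)"] sum.cong)

text \<open>
  Candidates for two sequences \<open>l\<close> and \<open>u\<close> with \<open>l 0 = u 0 = 1\<close>, with convolution \<open>ps\<close> and with
  at most \<open>b\<close> left for the sum of squares. The terms found so far are listed backwards and without
  the leading \<open>1\<close>; the entries are searched in \<open>{-2..2}\<close>, which is complete for \<open>b < 9\<close>.
\<close>

fun completions :: "int list \<Rightarrow> int \<Rightarrow> int list \<Rightarrow> int list \<Rightarrow> (int list \<times> int list) list" where
  "completions [] b L U = [(L, U)]"
| "completions (p # ps) b L U =
     (let c = p - sum_list (map2 (*) L (rev U)) in
      concat (map (\<lambda>l. let u = c - l; b' = b - l * l - u * u in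
        if b' < 0 then [] else completions ps b' (l # L) (u # U)) [-2, -1, 0, 1, 2]))"

lemma completions_ConsI:
  assumes "l \<in> {-2, -1, 0, 1, 2}" "p - sum_list (map2 (*) L (rev U)) - l = u"
    and "l * l + u * u \<le> b" "x \<in> set (completions ps (b - l * l - u * u) (l # L) (u # U))"
  shows "x \<in> set (completions (p # ps) b L U)"
  using assms by (auto simp: Let_def)

text \<open>As \<open>l 0 = u 0 = 1\<close>, the convolution equation at \<open>j\<close> fixes
  \<open>l j + u j\<close> in terms of earlier entries, so a guess for \<open>l j\<close> forces
  \<open>u j\<close>. The budget \<open>b < 9\<close> leaves only
  \<open>\<bar>l j\<bar> \<le> 2\<close>.\<close>

lemma completions_complete:
  fixes l u :: "nat \<Rightarrow> int"
  assumes "l 0 = 1" "u 0 = 1"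
    and conv: "\<And>j. 0 < j \<Longrightarrow> j < K \<Longrightarrow> (\<Sum>i\<le>j. l i * u (j - i)) = p j"
    and "0 < j" "j \<le> K" "b < 9"
    and "(\<Sum>i\<in>{j..<K}. (l i)\<^sup>2 + (u i)\<^sup>2) \<le> b"
  shows "(map l (rev [1..<K]), map u (rev [1..<K])) \<in>
    set (completions (map p [j..<K]) b (map l (rev [1..<j])) (map u (rev [1..<j])))"
  using assms(4-)
proof (induction "K - j" arbitrary: j b)
  case 0
  then show ?case by simp
next
  case (Suc n)
  then have j: "0 < j" "j < K" by auto
  have ivl: "{j..<K} = insert j {Suc j..<K}" using j by auto
  have le: "(l j)\<^sup>2 + (u j)\<^sup>2 + (\<Sum>i\<in>{Suc j..<K}. (l i)\<^sup>2 + (u i)\<^sup>2) \<le> b"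
    using Suc.prems(4) unfolding ivl by simp
  moreover have "0 \<le> (\<Sum>i\<in>{Suc j..<K}. (l i)\<^sup>2 + (u i)\<^sup>2)"
    by (intro sum_nonneg) auto
  ultimately have le': "(l j)\<^sup>2 + (u j)\<^sup>2 \<le> b" by simp
  then have "(l j)\<^sup>2 < 9" using Suc.prems(3) zero_le_power2[of "u j"] by linarith
  then have "\<bar>l j\<bar>\<^sup>2 < 3\<^sup>2" by simp
  then have "\<bar>l j\<bar> < 3" by (rule power2_less_imp_less) simp
  then have lj: "l j \<in> {-2, -1, 0, 1, 2}" by auto
  \<comment> \<open>Both lists are stored backwards; reversing one of them pairs
    \<open>l (j - i)\<close> with \<open>u i\<close>, which is the convolution without its two end
    terms.\<close>
  have "map2 (*) (map l (rev [1..<j])) (rev (map u (rev [1..<j]))) = map (\<lambda>i. l (j - i) * u i) [1..<j]"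
    by (rule nth_equalityI) (auto simp: rev_nth rev_map Suc_diff_Suc less_diff_conv)
  then have "sum_list (map2 (*) (map l (rev [1..<j])) (rev (map u (rev [1..<j]))))
      = (\<Sum>i\<in>{1..<j}. l (j - i) * u i)"
    by (simp add: sum_list_distinct_conv_sum_set)
  also have "\<dots> = (\<Sum>i\<in>{1..<j}. l i * u (j - i))"
    by (rule sum.reindex_bij_witness[of _ "\<lambda>i. j - i" "\<lambda>i. j - i"]) auto
  also have "\<dots> = p j - l j - u j"
  proof -
    have "{..j} = insert 0 (insert j {1..<j})" using j by auto
    then show ?thesis using conv[of j] j assms(1,2) by simp
  qed
  finally have c: "p j - sum_list (map2 (*) (map l (rev [1..<j])) (rev (map u (rev [1..<j])))) - l j = u j"
    by simp
  have lt: "b - l j * l j - u j * u j < 9"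
    using Suc.prems(3) zero_le_square[of "l j"] zero_le_square[of "u j"] by linarith
  have "(map l (rev [1..<K]), map u (rev [1..<K])) \<in>
      set (completions (map p [Suc j..<K]) (b - l j * l j - u j * u j)
        (l j # map l (rev [1..<j])) (u j # map u (rev [1..<j])))"
    using Suc.hyps(1)[of "Suc j" "b - l j * l j - u j * u j"] Suc.hyps(2) Suc.prems j le le' lt
    by (simp add: power2_eq_square algebra_simps)
  moreover have "l j * l j + u j * u j \<le> b"
    using le' by (simp add: power2_eq_square)
  ultimately show ?case
    unfolding upt_conv_Cons[OF j(2)] list.map using completions_ConsI[OF lj c] by blast
qed

text \<open>Below degree \<open>K\<close> the product with the reflection sees only the
  \<open>K\<close> lowest and \<open>K\<close> highest coefficients of \<open>H\<close>, so the
  search finds them. By \<open>full\<close> every solution exhausts the budget, which leaves nothing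
  for the coefficients in between.\<close>

theorem two_ended_rigidity:
  fixes H :: "int poly"
  assumes H: "degree H = N" "H * reflect_poly H = two_ended N lo hi * reflect_poly (two_ended N lo hi)"
    and len: "length lo = K" "length hi = K" "2 * K \<le> Suc N" "0 < K"
    and s: "hd lo * hd hi = s" "s \<in> {1, -1}"
    and b: "(\<Sum>x\<leftarrow>lo. x\<^sup>2) + (\<Sum>x\<leftarrow>hi. x\<^sup>2) = b + 2" "b < 9"
    and cs: "completions (map (\<lambda>j. s * (\<Sum>i\<leftarrow>[0..<Suc j]. lo ! i * hi ! (j - i))) [1..<K]) b [] [] = cs"
    and full: "\<And>L U. (L, U) \<in> set cs \<Longrightarrow> (\<Sum>x\<leftarrow>L. x\<^sup>2) + (\<Sum>x\<leftarrow>U. x\<^sup>2) = b"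
  obtains L U h where "(L, U) \<in> set cs" "h \<in> {1, -1}"
    "H = smult h (two_ended N (1 # rev L) (map ((*) s) (1 # rev U)))"
proof -
  let ?F = "two_ended N lo hi"
  have ne: "lo \<noteq> []" "hi \<noteq> []" using len by auto
  have hd0: "hd lo \<noteq> 0" "hd hi \<noteq> 0" using s by auto
  have lenle: "length lo + length hi \<le> Suc N" "length hi + length lo \<le> Suc N" using len by auto
  have refl: "reflect_poly ?F = two_ended N hi lo"
    using reflect_two_ended ne hd0 lenle by simp
  have low: "(\<Sum>i\<le>j. coeff H i * coeff H (N - (j - i))) = (\<Sum>i\<le>j. lo ! i * hi ! (j - i))" if "j < K" for j
  proof -
    have "(\<Sum>i\<le>j. coeff H i * coeff H (N - (j - i))) = coeff (H * reflect_poly H) j"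
      using that len H(1) by (auto simp: coeff_mult coeff_reflect_poly intro!: sum.cong)
    also have "\<dots> = coeff (?F * two_ended N hi lo) j" using H(2) refl by simp
    also have "\<dots> = (\<Sum>i\<le>j. lo ! i * hi ! (j - i))"
      using that len by (auto simp: coeff_mult coeff_two_ended intro!: sum.cong)
    finally show ?thesis .
  qed
  define h0 where "h0 = coeff H 0"
  define hN where "hN = coeff H N"
  have h0N: "h0 * hN = s"
    using low[of 0] len s ne by (simp add: h0_def hN_def hd_conv_nth)
  \<comment> \<open>The two end coefficients multiply to \<open>s = 1\<close> or
    \<open>s = -1\<close>, hence each is a unit.\<close>
  then have unit: "h0 \<in> {1, -1}" "hN \<in> {1, -1}"
    using s(2) zmult_eq_1_iff[of h0 hN] zmult_eq_1_iff[of h0 "-hN"] by auto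
  then have sq: "h0 * h0 = 1" "hN * hN = 1" by auto
  have sq2: "h0\<^sup>2 = 1" "hN\<^sup>2 = 1" using sq by (simp_all add: power2_eq_square)
  have hN: "hN = h0 * s" using h0N sq(1) by (metis mult.left_commute mult.right_neutral)
  \<comment> \<open>Dividing each end by its unit normalises the leading entries to 1, as the search
    expects; the convolution is thereby multiplied by \<open>h0 * hN = s\<close>.\<close>
  define l where "l i = h0 * coeff H i" for i
  define u where "u i = hN * coeff H (N - i)" for i
  have lu0: "l 0 = 1" "u 0 = 1" using sq by (simp_all add: l_def u_def flip: h0_def hN_def)
  have l2: "(l i)\<^sup>2 = (coeff H i)\<^sup>2" and u2: "(u i)\<^sup>2 = (coeff H (N - i))\<^sup>2" for i
    using unit by (auto simp: l_def u_def)
  have Hl: "coeff H i = h0 * l i" and Hu: "coeff H (N - i) = hN * u i" for i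
    using unit by (auto simp: l_def u_def)
  have energy: "(\<Sum>i\<le>N. (coeff H i)\<^sup>2) = b + 2"
  proof -
    have "(\<Sum>i\<le>N. (coeff H i)\<^sup>2) = coeff (H * reflect_poly H) N"
      using coeff_mult_reflect_poly_degree[of H] H(1) by simp
    also have "\<dots> = (\<Sum>i\<le>N. (coeff ?F i)\<^sup>2)"
      using coeff_mult_reflect_poly_degree[of ?F] H(2) degree_two_ended[OF lenle(1) ne(2) hd0(2)] by simp
    finally show ?thesis using energy_two_ended[OF len(1-3)] b(1) by simp
  qed
  define mid where "mid = (\<Sum>i\<in>{K..<Suc N - K}. (coeff H i)\<^sup>2)"
  have K1: "{..<K} = insert 0 {1..<K}" using len by auto
  have split: "(\<Sum>i\<in>{1..<K}. (l i)\<^sup>2) + (\<Sum>i\<in>{1..<K}. (u i)\<^sup>2) + mid = b"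
    using energy sum_coeff_ends[OF len(3), of H] lu0 unfolding mid_def
    by (simp add: K1 l2 u2 h0_def[symmetric] hN_def[symmetric] sq2)
  have mid0: "0 \<le> mid" unfolding mid_def by (intro sum_nonneg) auto
  define L where "L = map l (rev [1..<K])"
  define U where "U = map u (rev [1..<K])"
  have "(L, U) \<in> set (completions (map (\<lambda>j. s * (\<Sum>i\<leftarrow>[0..<Suc j]. lo ! i * hi ! (j - i))) [1..<K]) b
           (map l (rev [1..<1])) (map u (rev [1..<1])))"
    unfolding L_def U_def
  proof (rule completions_complete[where l = l and u = u, OF lu0])
    fix j assume j: "0 < j" "j < K"
    have "(\<Sum>i\<le>j. l i * u (j - i)) = (h0 * hN) * (\<Sum>i\<le>j. coeff H i * coeff H (N - (j - i)))"
      by (simp add: l_def u_def sum_distrib_left mult_ac)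
    also have "\<dots> = s * (\<Sum>i\<le>j. lo ! i * hi ! (j - i))" using low j h0N by simp
    also have "(\<Sum>i\<le>j. lo ! i * hi ! (j - i)) = (\<Sum>i\<leftarrow>[0..<Suc j]. lo ! i * hi ! (j - i))"
      by (subst sum_list_distinct_conv_sum_set) (auto simp: atLeast0LessThan lessThan_Suc_atMost simp del: upt_Suc)
    finally show "(\<Sum>i\<le>j. l i * u (j - i)) = s * (\<Sum>i\<leftarrow>[0..<Suc j]. lo ! i * hi ! (j - i))" .
  next
    show "(\<Sum>i\<in>{1..<K}. (l i)\<^sup>2 + (u i)\<^sup>2) \<le> b" using split mid0 by (simp add: sum.distrib)
  qed (use len b in auto)
  then have LU: "(L, U) \<in> set cs" using cs by simp
  have "(\<Sum>x\<leftarrow>L. x\<^sup>2) = (\<Sum>i\<in>{1..<K}. (l i)\<^sup>2)" "(\<Sum>x\<leftarrow>U. x\<^sup>2) = (\<Sum>i\<in>{1..<K}. (u i)\<^sup>2)"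
    by (simp_all add: L_def U_def o_def sum_list_distinct_conv_sum_set)
  \<comment> \<open>The budget is already spent on the two ends.\<close>
  then have "mid = 0" using full[OF LU] split by simp
  then have middle: "coeff H i = 0" if "K \<le> i" "i < Suc N - K" for i
    using that unfolding mid_def by (subst (asm) sum_nonneg_eq_0_iff) auto
  have upt: "[0..<K] = 0 # [1..<K]" using len(4) by (simp add: upt_conv_Cons)
  have L': "1 # rev L = map l [0..<K]" and U': "1 # rev U = map u [0..<K]"
    using lu0 by (simp_all add: L_def U_def rev_map upt)
  have "H = smult h0 (two_ended N (1 # rev L) (map ((*) s) (1 # rev U)))"
  proof (rule poly_eqI)
    fix i
    consider "i < K" | "K \<le> i" "i < Suc N - K" | "Suc N - K \<le> i" "i \<le> N" | "N < i" by linarith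
    then show "coeff H i = coeff (smult h0 (two_ended N (1 # rev L) (map ((*) s) (1 # rev U)))) i"
    proof cases
      case 3
      then have "coeff H i = hN * u (N - i)" using Hu[of "N - i"] by simp
      then show ?thesis using 3 len unfolding L' U' coeff_smult
        by (subst coeff_two_ended) (auto simp: hN)
    next
      case 4
      then show ?thesis using H(1) len by (simp add: L' U' coeff_two_ended coeff_eq_0)
    qed (use len middle Hl in \<open>auto simp: L' U' coeff_two_ended\<close>)
  qed
  then show thesis using that LU unit by blast
qed

section \<open>Ljunggren's method\<close>

lemma reflect_of_int_poly:
  "reflect_poly (of_int_poly p :: 'a :: {ring_char_0, idom} poly) = of_int_poly (reflect_poly p)"
  by (intro poly_eqI) (simp add: coeff_reflect_poly)

text \<open>Equality with the reflection up to sign makes the nonzero roots stable under inversion,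
  and 0 is not a root because of the constant term.\<close>

lemma reciprocal_root:
  fixes p :: "int poly"
  assumes "reflect_poly p \<in> {p, -p}" "degree p > 0" "coeff p 0 \<noteq> 0"
  obtains z :: complex where "poly (of_int_poly p) z = 0" "poly (of_int_poly p) (inverse z) = 0"
proof -
  have "\<not> constant (poly (of_int_poly p :: complex poly))"
    using assms(2) by (simp add: constant_degree)
  then obtain z :: complex where z: "poly (of_int_poly p) z = 0"
    using fundamental_theorem_of_algebra by blast
  have "z \<noteq> 0"
    using z assms(3) by (auto simp: poly_0_coeff_0)
  moreover have "poly (reflect_poly (of_int_poly p)) z = 0"
    using assms(1) z by (auto simp: reflect_of_int_poly hom_distribs)
  ultimately have "poly (of_int_poly p) (inverse z) = 0"
    by (simp add: poly_reflect_poly_nz)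
  with z show thesis by (rule that)
qed

text \<open>
  Ljunggren's method: for \<open>E = p * r\<close> the polynomial \<open>W * p * reflect_poly r\<close> has the same product
  with its reflection as \<open>W * E\<close>; rigidity then makes one of the factors reciprocal.
\<close>

lemma irreducible_if_rigid:
  fixes W E :: "int poly"
  assumes W: "reflect_poly W \<in> {W, -W}"
    and nz: "coeff (W * E) 0 \<noteq> 0" and deg: "degree E > 0"
    and rigid: "\<And>H. W dvd H \<Longrightarrow> degree H = degree (W * E) \<Longrightarrow>
       H * reflect_poly H = W * E * reflect_poly (W * E) \<Longrightarrow>
       H \<in> {W * E, - (W * E), reflect_poly (W * E), - reflect_poly (W * E)}"
    and no_pair: "\<And>z :: complex. poly (of_int_poly E) z = 0 \<Longrightarrow> poly (of_int_poly E) (inverse z) \<noteq> 0"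
  shows "irreducible\<^sub>d E"
proof (rule irreducible\<^sub>dI[OF deg])
  fix p r assume pr: "degree p > 0" "degree r > 0" "E = p * r"
  have nz': "coeff W 0 \<noteq> 0" "coeff p 0 \<noteq> 0" "coeff r 0 \<noteq> 0"
    using nz by (auto simp: coeff_mult_0 pr(3))
  then have nz0: "W \<noteq> 0" "p \<noteq> 0" "r \<noteq> 0" "reflect_poly W \<noteq> 0" "reflect_poly r \<noteq> 0" "reflect_poly p \<noteq> 0" by auto
  define H where "H = W * p * reflect_poly r"
  have "reflect_poly H = reflect_poly W * reflect_poly p * r"
    using nz' by (simp add: H_def reflect_poly_mult)
  then have "H * reflect_poly H = W * E * reflect_poly (W * E)"
    by (simp only: H_def pr(3) reflect_poly_mult mult_ac)
  moreover have "degree H = degree (W * E)"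
    using nz0 nz' by (simp add: H_def pr(3) degree_mult_eq)
  moreover have "W dvd H" by (simp add: H_def)
  ultimately consider "H = W * E" | "H = - (W * E)" | "H = reflect_poly (W * E)" | "H = - reflect_poly (W * E)"
    using rigid by blast
  then have "reflect_poly r \<in> {r, -r} \<or> reflect_poly p \<in> {p, -p}"
  proof cases
    \<comment> \<open>When \<open>H\<close> is \<open>W * E\<close> up to sign, cancelling
      \<open>W * p\<close> shows that \<open>r\<close> is reciprocal up to sign.\<close>
    case 1
    then have "(W * p) * reflect_poly r = (W * p) * r" by (simp add: H_def pr(3) mult_ac)
    then show ?thesis using nz0 by (simp only: mult_cancel_left) auto
  next
    case 2
    then have "(W * p) * reflect_poly r = (W * p) * (- r)" by (simp add: H_def pr(3) mult_ac)
    then show ?thesis using nz0 by (simp only: mult_cancel_left) auto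
  next
    \<comment> \<open>When \<open>H\<close> is the reflection of \<open>W * E\<close> up to sign,
      cancelling the reflection of \<open>r\<close> and using that \<open>W\<close> is reciprocal up
      to sign shows the same for \<open>p\<close>.\<close>
    case 3
    then have "reflect_poly r * (W * p) = reflect_poly r * (reflect_poly W * reflect_poly p)"
      by (simp add: H_def pr(3) mult_ac reflect_poly_mult)
    then have "W * p = reflect_poly W * reflect_poly p" using nz0 by (simp only: mult_cancel_left) auto
    then have "W * reflect_poly p = W * p \<or> W * reflect_poly p = W * (- p)" using W by auto
    then show ?thesis using nz0 by (simp only: mult_cancel_left) auto
  next
    case 4
    then have "reflect_poly r * (W * p) = reflect_poly r * (- (reflect_poly W * reflect_poly p))"
      by (simp add: H_def pr(3) mult_ac reflect_poly_mult)
    then have "W * p = - (reflect_poly W * reflect_poly p)" using nz0 by (simp only: mult_cancel_left) auto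
    then have "W * reflect_poly p = W * p \<or> W * reflect_poly p = W * (- p)" using W by auto
    then show ?thesis using nz0 by (simp only: mult_cancel_left) auto
  qed
  then obtain z :: complex where "poly (of_int_poly E) z = 0" "poly (of_int_poly E) (inverse z) = 0"
    using reciprocal_root[of r] reciprocal_root[of p] pr nz' by (auto simp: hom_distribs)
  with no_pair show False by blast
qed

section \<open>Cyclotomic polynomials\<close>

abbreviation root_of_unity :: "nat \<Rightarrow> nat \<Rightarrow> complex" where
  "root_of_unity d k \<equiv> cis (2 * pi * real k / real d)"

abbreviation coprimes :: "nat \<Rightarrow> nat set" where
  "coprimes d \<equiv> {k. 1 \<le> k \<and> k \<le> d \<and> coprime k d}"

lemma root_of_unity_power_eq_1_iff:
  assumes "d > 0"
  shows "root_of_unity d k ^ e = 1 \<longleftrightarrow> d dvd k * e"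
proof -
  have "root_of_unity d k ^ e = cis (2 * pi * real (k * e) / real d)"
    by (simp add: DeMoivre mult_ac)
  also have "\<dots> = 1 \<longleftrightarrow> (\<exists>i. real (k * e) / real d = of_int i)"
  proof -
    have "2 * pi * real (k * e) / real d = of_int i * (2 * pi) \<longleftrightarrow> real (k * e) / real d = of_int i" for i
      using pi_gt_zero mult_cancel_left[of "2 * pi" "real (k * e) / real d" "of_int i"] by (simp add: mult_ac)
    then show ?thesis by (simp only: cis_eq_1_iff)
  qed
  also have "\<dots> \<longleftrightarrow> (\<exists>i. int (k * e) = i * int d)"
  proof -
    have "real (k * e) / real d = of_int i \<longleftrightarrow> int (k * e) = i * int d" for i
    proof -
      have "real (k * e) / real d = of_int i \<longleftrightarrow> (of_int (int (k * e)) :: real) = of_int (i * int d)"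
        using assms by (simp add: field_simps)
      then show ?thesis by (simp only: of_int_eq_iff)
    qed
    then show ?thesis by simp
  qed
  also have "\<dots> \<longleftrightarrow> d dvd k * e"
    by (metis dvd_def mult.commute of_nat_dvd_iff)
  finally show ?thesis .
qed

lemma inj_on_root_of_unity: "inj_on (root_of_unity d) (coprimes d)"
proof (cases "d \<ge> 2")
  case True
  \<comment> \<open>The index \<open>k = d\<close> is coprime to \<open>d\<close> only for
    \<open>d = 1\<close>; for larger \<open>d\<close> the indices fall into the range from 0 to
    \<open>d - 1\<close> of the standard enumeration.\<close>
  have "coprimes d \<subseteq> {..<d}"
  proof
    fix k assume "k \<in> coprimes d"
    then show "k \<in> {..<d}" using True by (cases "k = d") auto
  qed
  then show ?thesis
    using bij_betw_roots_unity[of d] True by (auto simp: bij_betw_def intro: inj_on_subset)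
qed (force intro: inj_onI)

definition primitive_roots :: "nat \<Rightarrow> complex set" where
  "primitive_roots d = root_of_unity d ` coprimes d"

lemma finite_primitive_roots [simp]: "finite (primitive_roots d)"
proof -
  have "coprimes d \<subseteq> {..d}" by auto
  then show ?thesis unfolding primitive_roots_def by (blast intro: finite_subset)
qed

lemma primitive_roots_power_eq_1_iff:
  assumes "z \<in> primitive_roots d"
  shows "z ^ e = 1 \<longleftrightarrow> d dvd e"
proof -
  obtain k where k: "1 \<le> k" "k \<le> d" "coprime k d" "z = root_of_unity d k"
    using assms by (auto simp: primitive_roots_def)
  then show ?thesis
    using root_of_unity_power_eq_1_iff[of d k e]
    by (metis coprime_commute coprime_dvd_mult_right_iff le_trans less_eq_Suc_le One_nat_def)
qed

text \<open>Write \<open>z\<close> as the root with index \<open>k\<close> out of \<open>n\<close>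
  and reduce the fraction \<open>k / n\<close> to lowest terms.\<close>

lemma primitive_roots_cover:
  assumes "z ^ n = 1" "n > 0"
  obtains d where "d dvd n" "z \<in> primitive_roots d"
proof -
  obtain k where k: "k < n" "z = root_of_unity n k"
    using bij_betw_roots_unity[OF assms(2)] assms(1) by (auto simp: bij_betw_def)
  \<comment> \<open>The root 1 has index 0 in the enumeration, but \<open>coprimes\<close> starts at
    1, so index \<open>n\<close> is taken instead.\<close>
  define k' where "k' = (if k = 0 then n else k)"
  have k': "1 \<le> k'" "k' \<le> n" "z = root_of_unity n k'"
    using k assms(2) by (auto simp: k'_def)
  define g where "g = gcd k' n"
  have g: "g > 0" "g dvd k'" "g dvd n" using assms(2) by (auto simp: g_def)
  have "z = root_of_unity (n div g) (k' div g)"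
    using g assms(2) k'(3) by (auto elim!: dvdE simp: mult_ac)
  moreover have "coprime (k' div g) (n div g)"
    unfolding g_def using assms(2) by (intro div_gcd_coprime) auto
  moreover have "1 \<le> k' div g" "k' div g \<le> n div g"
    using k' g by (auto simp: div_greater_zero_iff dvd_imp_le div_le_mono Suc_le_eq)
  ultimately have "z \<in> primitive_roots (n div g)"
    by (auto simp: primitive_roots_def)
  moreover have "n div g dvd n" using g by auto
  ultimately show thesis using that by blast
qed

lemma disjoint_primitive_roots:
  assumes "c \<noteq> d"
  shows "primitive_roots c \<inter> primitive_roots d = {}"
proof (rule equals0I)
  fix z assume z: "z \<in> primitive_roots c \<inter> primitive_roots d"
  then have "c dvd d" "d dvd c"
    using primitive_roots_power_eq_1_iff[of z c d] primitive_roots_power_eq_1_iff[of z d d]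
      primitive_roots_power_eq_1_iff[of z d c] primitive_roots_power_eq_1_iff[of z c c] by auto
  then show False using assms dvd_antisym by blast
qed

lemma prod_primitive_roots:
  "(\<Prod>k\<in>coprimes d. [:- root_of_unity d k, 1:]) = (\<Prod>z\<in>primitive_roots d. [:- z, 1:])"
  unfolding primitive_roots_def by (subst prod.reindex[OF inj_on_root_of_unity]) (simp add: o_def)

text \<open>\<open>cyclotomic\<close> is a definite description over integer polynomials. Uniqueness
  comes from the embedding into complex polynomials; an integral witness \<open>p\<close> must be
  supplied for each \<open>d\<close>.\<close>

lemma cyclotomic_eqI:
  assumes "of_int_poly p = (\<Prod>z\<in>primitive_roots d. [:- z, 1:])"
  shows "cyclotomic d = p"
  unfolding cyclotomic_def
proof (rule the_equality)
  show "of_int_poly p = (\<Prod>k\<in>coprimes d. [:- root_of_unity d k, 1:])"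
    using assms unfolding prod_primitive_roots .
next
  fix q :: "int poly"
  assume "of_int_poly q = (\<Prod>k\<in>coprimes d. [:- root_of_unity d k, 1:])"
  then have "(of_int_poly q :: complex poly) = of_int_poly p"
    using assms unfolding prod_primitive_roots by simp
  then show "q = p" by (simp add: of_int_poly_hom.injectivity)
qed

lemma monic_linear_prod: "lead_coeff (\<Prod>z\<in>Z. [:- z, 1 :: 'a :: idom:]) = 1"
  by (simp add: lead_coeff_prod)

lemma prod_linear_dvd:
  fixes p :: "'a :: field poly"
  assumes "finite Z" "\<And>z. z \<in> Z \<Longrightarrow> poly p z = 0"
  shows "(\<Prod>z\<in>Z. [:- z, 1:]) dvd p"
  using assms
proof (induction Z arbitrary: p rule: finite_induct)
  case (insert x Z)
  then obtain q where q: "p = [:- x, 1:] * q"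
    using poly_eq_0_iff_dvd[of p x] by (auto elim: dvdE)
  have "poly q z = 0" if "z \<in> Z" for z
    using insert.prems[of z] insert.hyps(2) that q by auto
  then have "(\<Prod>z\<in>Z. [:- z, 1:]) dvd q" by (rule insert.IH)
  then show ?case using insert.hyps q by (simp add: mult_dvd_mono del: mult_pCons_left)
qed auto

text \<open>Both sides are monic of degree \<open>n\<close> and agree at \<open>n\<close>
  points.\<close>

lemma prod_roots_unity:
  assumes "n > 0"
  shows "(\<Prod>z | z ^ n = 1. [:- z :: complex, 1:]) = monom 1 n - 1"
proof (rule poly_eqI_degree_lead_coeff[of _ n _ "{z. z ^ n = 1}"])
  have fin: "finite {z :: complex. z ^ n = 1}" using assms by (intro finite_roots_unity) simp
  have deg: "degree (\<Prod>z | z ^ n = 1. [:- z :: complex, 1:]) = n"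
    using card_roots_unity_eq[OF assms] by (subst degree_prod_eq_sum_degree) auto
  show "degree (\<Prod>z | z ^ n = 1. [:- z :: complex, 1:]) \<le> n" using deg by simp
  show "degree (monom 1 n - 1 :: complex poly) \<le> n" by (intro degree_diff_le) (auto simp: degree_monom_le)
  show "n \<le> card {z :: complex. z ^ n = 1}" using card_roots_unity_eq[OF assms] by simp
  show "coeff (\<Prod>z | z ^ n = 1. [:- z :: complex, 1:]) n = coeff (monom 1 n - 1) n"
    using monic_linear_prod[of "{z :: complex. z ^ n = 1}"] deg assms by simp
  show "poly (\<Prod>z | z ^ n = 1. [:- z, 1:]) z = poly (monom 1 n - 1) z" if "z \<in> {z :: complex. z ^ n = 1}" for z
    using that fin by (auto simp: poly_prod poly_monom)
qed

lemma roots_unity_Un_primitive_roots: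
  assumes "n > 0"
  shows "{z. z ^ n = 1} = (\<Union>d\<in>{d. d dvd n}. primitive_roots d)"
proof (intro equalityI subsetI)
  fix z :: complex assume "z \<in> {z. z ^ n = 1}"
  then obtain d where "d dvd n" "z \<in> primitive_roots d"
    using primitive_roots_cover[of z n] assms by auto
  then show "z \<in> (\<Union>d\<in>{d. d dvd n}. primitive_roots d)" by auto
next
  fix z assume "z \<in> (\<Union>d\<in>{d. d dvd n}. primitive_roots d)"
  then obtain d where "d dvd n" "z \<in> primitive_roots d" by auto
  then show "z \<in> {z. z ^ n = 1}" by (simp add: primitive_roots_power_eq_1_iff)
qed

lemma primitive_roots_1: "primitive_roots (Suc 0) = {1}"
proof -
  have "coprimes (Suc 0) = {Suc 0}" by auto
  then show ?thesis by (simp add: primitive_roots_def)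
qed

section \<open>q-integers and cyclotomic polynomials of small index\<close>

definition qnum :: "nat \<Rightarrow> int poly" where
  "qnum k = (\<Sum>i<k. monom 1 i)"

lemma qnum_mult: "(monom 1 1 - 1) * qnum k = monom 1 k - 1"
  unfolding qnum_def
  by (induction k) (simp_all add: algebra_simps mult_monom one_pCons monom_0)

text \<open>For prime \<open>p\<close> every \<open>p\<close>-th root of unity except 1 is
  primitive; dividing \<open>q^p - 1\<close> by \<open>q - 1\<close> gives the q-integer.\<close>

lemma prod_primitive_roots_prime:
  assumes "prime p"
  shows "(\<Prod>z\<in>primitive_roots p. [:- z, 1:]) = of_int_poly (qnum p)"
proof -
  have p: "p > 0" "p \<noteq> Suc 0" using assms prime_gt_0_nat by auto
  have "{d. d dvd p} = {1, p}"
    using assms prime_nat_iff by auto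
  then have "{z :: complex. z ^ p = 1} = {1} \<union> primitive_roots p"
    using roots_unity_Un_primitive_roots[OF p(1)] by (simp add: primitive_roots_1)
  moreover have "1 \<notin> primitive_roots p"
    using primitive_roots_power_eq_1_iff[of 1 p 1] p by auto
  ultimately have "[:- 1, 1:] * (\<Prod>z\<in>primitive_roots p. [:- z, 1:]) = monom 1 p - 1"
    using prod_roots_unity[OF p(1)] by simp
  also have "\<dots> = of_int_poly ((monom 1 1 - 1) * qnum p)"
    unfolding qnum_mult by (simp add: hom_distribs)
  also have "\<dots> = [:- 1, 1:] * of_int_poly (qnum p)"
    by (simp add: hom_distribs monom_Suc monom_0 one_pCons)
  finally show ?thesis by (simp only: mult_cancel_left) auto
qed

lemma cyclotomic_prime: "prime p \<Longrightarrow> cyclotomic p = qnum p"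
  by (rule cyclotomic_eqI[OF prod_primitive_roots_prime[symmetric]])

text \<open>4 is the only composite index required: the sets \<open>D_set a\<close> for the given
  \<open>a\<close> contain only 2, 3, 4, 5 and 7.\<close>

lemma prod_primitive_roots_4: "(\<Prod>z\<in>primitive_roots 4. [:- z, 1:]) = of_int_poly (monom 1 2 + 1)"
proof -
  have "coprimes 4 = {1, 3}"
  proof -
    have "k = 1 \<or> k = 3" if "1 \<le> k" "k \<le> 4" "coprime k 4" for k :: nat
    proof -
      have "\<not> 2 dvd k" using that(3) coprime_common_divisor[of k 4 2] by auto
      then show ?thesis using that(1,2) by presburger
    qed
    moreover have "coprime 3 (Suc 3)" by (rule coprime_Suc_right_nat)
    ultimately show ?thesis by auto
  qed
  then have "primitive_roots 4 = {root_of_unity 4 1, root_of_unity 4 3}"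
    unfolding primitive_roots_def by (simp only: image_insert image_empty)
  moreover have "root_of_unity 4 1 = \<i>" "root_of_unity 4 3 = - \<i>"
    using cos_3over2_pi sin_3over2_pi by (simp_all add: complex_eq_iff mult_ac)
  ultimately have "primitive_roots 4 = {\<i>, - \<i>}" by (simp only:)
  moreover have "\<i> \<noteq> - \<i>" by (simp add: complex_eq_iff)
  ultimately have "(\<Prod>z\<in>primitive_roots 4. [:- z, 1:]) = [:- \<i>, 1:] * [:- (- \<i>), 1:]"
    by (simp only: prod.insert finite.intros prod.empty insert_iff empty_iff mult_1_right) simp
  also have "\<dots> = [:1, 0, 1:]" by simp
  also have "\<dots> = of_int_poly (monom 1 2 + 1)"
    by (simp add: numeral_2_eq_2 monom_Suc monom_0 one_pCons)
  finally show ?thesis .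
qed

lemma cyclotomic_4: "cyclotomic 4 = monom 1 2 + 1"
  by (rule cyclotomic_eqI[OF prod_primitive_roots_4[symmetric]])

text \<open>Pseudo-division by a monic polynomial is true division over the integers. The remainder
  is still divisible by \<open>p\<close> over the field but has smaller degree, so it
  vanishes.\<close>

lemma of_int_poly_dvd_monic:
  fixes p q :: "int poly"
  assumes "(of_int_poly p :: 'a :: field_char_0 poly) dvd of_int_poly q" "lead_coeff p = 1"
  shows "p dvd q"
proof -
  obtain s r where sr: "pseudo_divmod q p = (s, r)" by (cases "pseudo_divmod q p") auto
  have "p \<noteq> 0" using assms(2) by auto
  from pseudo_divmod[OF this sr] assms(2) have q: "q = p * s + r" "r = 0 \<or> degree r < degree p" by auto
  have "(of_int_poly p :: 'a poly) dvd of_int_poly r"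
    using assms(1) unfolding q(1) by (simp add: hom_distribs dvd_add_right_iff)
  then have "r = 0"
    using q(2) dvd_imp_degree_le[of "of_int_poly p :: 'a poly" "of_int_poly r"]
    by (metis leD of_int_poly_hom.hom_0_iff of_int_hom.degree_map_poly_hom)
  then show ?thesis using q(1) by simp
qed

section \<open>Irreducibility over the rationals\<close>

lemma rat_poly_common_denominator:
  fixes p :: "rat poly"
  obtains c :: int and P where "c \<noteq> 0" "smult (of_int c) p = of_int_poly P"
proof -
  have "\<exists>c :: int. \<exists>P. c \<noteq> 0 \<and> smult (of_int c) p = of_int_poly P"
  proof (induction p)
    case 0
    have "(1 :: int) \<noteq> 0 \<and> smult (of_int 1) 0 = (of_int_poly 0 :: rat poly)" by simp
    then show ?case by blast
  next
    case (pCons a p)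
    from pCons.IH obtain c :: int and P where c: "c \<noteq> 0" "smult (of_int c) p = of_int_poly P" by auto
    obtain n d where a: "a = of_int n / of_int d" "d \<noteq> 0"
      by (cases a) (auto simp: Fract_of_int_quotient)
    have "of_int (c * d) * a = of_int (c * n)" using a by simp
    moreover have "smult (of_int (c * d)) p = smult (of_int d) (of_int_poly P)"
      unfolding c(2)[symmetric] by (simp add: mult.commute)
    ultimately have "smult (of_int (c * d)) (pCons a p) = of_int_poly (pCons (c * n) (smult d P))"
      by (simp only: smult_pCons map_poly_pCons of_int_0 of_int_hom.map_poly_hom_smult
          of_int_hom.map_poly_pCons_hom)
    moreover have "c * d \<noteq> 0" using a(2) c(1) by simp
    ultimately show ?case by (intro exI conjI)
  qed
  then show thesis using that by auto
qed

text \<open>Gauss's lemma: after clearing denominators, the primitive parts of two rational factors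
  multiply to the primitive part of \<open>E\<close> up to sign, which yields an integral
  factorisation with the same degrees.\<close>

lemma irreducible_of_int_poly_rat:
  fixes E :: "int poly"
  assumes "irreducible\<^sub>d E"
  shows "irreducible (of_int_poly E :: rat poly)"
  unfolding irreducible_connect_field[symmetric]
proof (rule irreducible\<^sub>dI)
  show "0 < degree (of_int_poly E :: rat poly)"
    using assms by (simp add: irreducible\<^sub>d_def)
  fix p r :: "rat poly"
  assume deg: "degree p < degree (of_int_poly E :: rat poly)" "degree r < degree (of_int_poly E :: rat poly)"
    and E: "of_int_poly E = p * r"
  obtain c P where P: "c \<noteq> 0" "smult (of_int c) p = of_int_poly P" by (rule rat_poly_common_denominator)
  obtain d R where R: "d \<noteq> 0" "smult (of_int d) r = of_int_poly R" by (rule rat_poly_common_denominator)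
  have "(of_int_poly (P * R) :: rat poly) = smult (of_int c) p * smult (of_int d) r"
    by (simp add: of_int_poly_hom.hom_mult P R)
  also have "\<dots> = of_int_poly (smult (c * d) E)"
    by (simp add: of_int_hom.map_poly_hom_smult E mult_ac)
  finally have "P * R = smult (c * d) E" by (simp add: of_int_poly_hom.injectivity)
  then have eq: "primitive_part P * primitive_part R = smult (unit_factor (c * d)) (primitive_part E)"
    by (metis primitive_part_mult primitive_part_smult)
  define u where "u = unit_factor (c * d)"
  have "u * u = 1" using P(1) R(1) sgn_mult_self_eq[of "c * d"] by (simp add: u_def mult_ac)
  then have E': "E = smult (content E * u) (primitive_part P) * primitive_part R"
    by (simp only: mult_smult_left eq[folded u_def] smult_smult mult.assoc
        mult_1_right content_times_primitive_part)
  have dP: "degree P = degree p" using arg_cong[OF P(2), of degree] P(1) by (simp only: degree_smult_eq of_int_eq_0_iff of_int_hom.degree_map_poly_hom if_False)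
  have dR: "degree R = degree r" using arg_cong[OF R(2), of degree] R(1) by (simp only: degree_smult_eq of_int_eq_0_iff of_int_hom.degree_map_poly_hom if_False)
  have "degree (smult (content E * u) (primitive_part P)) < degree E"
    using deg(1) degree_smult_le[of "content E * u" "primitive_part P"] dP by simp
  moreover have "degree (primitive_part R) < degree E" using deg(2) dR by simp
  moreover have "E \<noteq> q * q'" if "degree q < degree E" "degree q' < degree E" for q q'
    using assms that by (simp add: irreducible\<^sub>d_def)
  ultimately show False using E' by metis
qed

section \<open>The denominators and their roots\<close>

definition denom :: "nat \<Rightarrow> nat \<Rightarrow> nat \<Rightarrow> int poly" where
  "denom a b m = qnum b + monom 1 1 * qnum a * qnum m"

lemma poly_qnum_1: "poly (qnum k) 1 = int k"
  by (simp add: qnum_def poly_sum poly_monom)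

lemma denom_mult: "(monom 1 1 - 1)\<^sup>2 * denom a b m
    = (monom 1 1 - 1) * (monom 1 b - 1) + monom 1 1 * (monom 1 a - 1) * (monom 1 m - 1)"
proof -
  have "(monom 1 1 - 1)\<^sup>2 * denom a b m = (monom 1 1 - 1) * ((monom 1 1 - 1) * qnum b)
      + monom 1 1 * ((monom 1 1 - 1) * qnum a) * ((monom 1 1 - 1) * qnum m)"
    by (simp add: denom_def power2_eq_square algebra_simps)
  then show ?thesis by (simp only: qnum_mult)
qed

lemma poly_denom_mult:
  fixes z :: complex
  shows "(z - 1)\<^sup>2 * poly (of_int_poly (denom a b m)) z
    = (z - 1) * (z ^ b - 1) + z * (z ^ a - 1) * (z ^ m - 1)"
  using arg_cong[OF denom_mult[of a b m], of "\<lambda>p. poly (of_int_poly p) z"]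
  by (simp add: of_int_poly_hom.hom_mult of_int_poly_hom.hom_minus of_int_poly_hom.hom_add
      of_int_poly_hom.hom_power poly_monom)

text \<open>Differentiate the sparse identity; at a root of the denominator the term from the
  derivative of \<open>(z - 1)^2\<close> disappears. The extra factor \<open>z\<close> restores full
  exponents, so that only \<open>z^a\<close>, \<open>z^b\<close> and \<open>z^m\<close>
  occur.\<close>

lemma poly_pderiv_denom:
  fixes z :: complex
  assumes "poly (of_int_poly (denom a b m)) z = 0" "0 < a" "0 < b" "0 < m"
  shows "z * ((z - 1)\<^sup>2 * poly (of_int_poly (pderiv (denom a b m))) z)
    = z * (z ^ b - 1) + (z - 1) * of_nat b * z ^ b + z * (z ^ a - 1) * (z ^ m - 1)
      + z * of_nat a * z ^ a * (z ^ m - 1) + z * (z ^ a - 1) * of_nat m * z ^ m"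
proof -
  let ?S = "of_int_poly (denom a b m) :: complex poly"
  have "pderiv ((monom 1 1 - 1)\<^sup>2 * ?S)
     = pderiv ((monom 1 1 - 1) * (monom 1 b - 1) + monom 1 1 * (monom 1 a - 1) * (monom 1 m - 1))"
    using arg_cong[OF denom_mult[of a b m], of "\<lambda>p. pderiv (of_int_poly p :: complex poly)"]
    by (simp add: of_int_poly_hom.hom_mult of_int_poly_hom.hom_minus of_int_poly_hom.hom_add
      of_int_poly_hom.hom_power)
  from arg_cong[OF this, of "\<lambda>p. z * poly p z"] assms(1)
  have "z * ((z - 1)\<^sup>2 * poly (pderiv ?S) z) = z * ((z ^ b - 1) + (z - 1) * (of_nat b * z ^ (b - 1))
      + (z ^ a - 1) * (z ^ m - 1) + z * (of_nat a * z ^ (a - 1)) * (z ^ m - 1)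
      + z * (z ^ a - 1) * (of_nat m * z ^ (m - 1)))"
    by (simp add: pderiv_mult pderiv_add pderiv_diff pderiv_monom poly_monom power2_eq_square algebra_simps)
  also have "\<dots> = z * (z ^ b - 1) + (z - 1) * of_nat b * (z * z ^ (b - 1)) + z * (z ^ a - 1) * (z ^ m - 1)
      + z * of_nat a * (z * z ^ (a - 1)) * (z ^ m - 1) + z * (z ^ a - 1) * of_nat m * (z * z ^ (m - 1))"
    by (simp add: algebra_simps)
  also have "\<dots> = z * (z ^ b - 1) + (z - 1) * of_nat b * z ^ b + z * (z ^ a - 1) * (z ^ m - 1)
      + z * of_nat a * z ^ a * (z ^ m - 1) + z * (z ^ a - 1) * of_nat m * z ^ m"
    using assms(2-4) by (simp add: power_eq_if)
  finally show ?thesis by (simp add: of_int_hom.map_poly_pderiv)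
qed

section \<open>Roots of the denominators: reciprocal pairs, roots of unity, multiplicity\<close>

lemma power_pred_eq_1_iff:
  fixes z :: complex
  assumes "0 < a" "z \<noteq> 0"
  shows "z ^ (a - 1) = 1 \<longleftrightarrow> z ^ a = z"
  using assms by (cases a) auto

text \<open>Treat \<open>z^a\<close>, \<open>z^b\<close>, \<open>z^m\<close> as unknowns
  \<open>A\<close>, \<open>B\<close>, \<open>M\<close>, where \<open>B\<close> is \<open>z\<close>
  or \<open>A / z\<close>. Both equations are then linear in \<open>M\<close>, and eliminating
  \<open>M\<close> leaves a product of factors such as \<open>z - 1\<close>, \<open>A - z\<close>
  and \<open>A * z - 1\<close>.\<close>

lemma denom_root_pair:
  fixes z :: complex
  assumes "poly (of_int_poly (denom a b m)) z = 0" "poly (of_int_poly (denom a b m)) (inverse z) = 0"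
    and "b = 1 \<or> b = a - 1" "2 \<le> a" "0 < m"
  shows "z = 1 \<or> z ^ (a - 1) = 1 \<or> z ^ (a + 1) = 1"
proof (rule ccontr)
  assume contra: "\<not> ?thesis"
  define A where "A = z ^ a"
  define B where "B = z ^ b"
  define M where "M = z ^ m"
  have eq: "(z - 1) * (B - 1) + z * (A - 1) * (M - 1) = 0"
    using poly_denom_mult[of z a b m] assms(1) by (simp add: A_def B_def M_def)
  \<comment> \<open>At \<open>z = 0\<close> the equation would read \<open>1 = 0\<close>, since
    \<open>b\<close> is positive.\<close>
  have z: "z \<noteq> 0"
    using eq assms(3-5) by (auto simp: A_def B_def M_def power_0_left)
  then have nz: "A \<noteq> 0" "B \<noteq> 0" "M \<noteq> 0" by (auto simp: A_def B_def M_def)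
  have "(1 / z - 1) * (1 / B - 1) + 1 / z * (1 / A - 1) * (1 / M - 1) = 0"
    using poly_denom_mult[of "inverse z" a b m] assms(2)
    by (simp add: A_def B_def M_def power_inverse divide_inverse)
  moreover have "(1 - z) * (1 - B) * A * M + B * (1 - A) * (1 - M)
      = z * B * A * M * ((1 / z - 1) * (1 / B - 1) + 1 / z * (1 / A - 1) * (1 / M - 1))"
    using z nz by (simp add: field_simps)
  ultimately have eq': "(1 - z) * (1 - B) * A * M + B * (1 - A) * (1 - M) = 0" by simp
  have ne: "A \<noteq> z" "A * z \<noteq> 1" "z \<noteq> 1"
    using contra power_pred_eq_1_iff[of a z] z assms(4) by (auto simp: A_def mult.commute)
  from assms(3) show False
  proof
    assume "b = 1"
    then have B: "B = z" by (simp add: B_def)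
    \<comment> \<open>The difference of the two equations gives \<open>A * M = 1\<close>, which is
      put back into the first.\<close>
    have "(z - 1)\<^sup>2 * (A * M - 1) = ((1 - z) * (1 - B) * A * M + B * (1 - A) * (1 - M))
        - ((z - 1) * (B - 1) + z * (A - 1) * (M - 1))"
      unfolding B by (simp add: algebra_simps power2_eq_square)
    then have "(z - 1)\<^sup>2 * (A * M - 1) = 0" using eq eq' by simp
    then have AM: "A * M - 1 = 0" using ne by simp
    have "(z - A) * (A * z - 1) = A * ((z - 1) * (B - 1) + z * (A - 1) * (M - 1)) - z * (A - 1) * (A * M - 1)"
      unfolding B by (simp add: algebra_simps power2_eq_square)
    then have "(z - A) * (A * z - 1) = 0" unfolding eq AM by simp
    then show False using ne by simp
  next
    assume "b = a - 1"
    then have B: "B * z = A" using assms(4) power_minus_mult[of a z] by (simp add: A_def B_def)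
    then have Bz: "B * z - A = 0" by simp
    have "(z - 1) * (A - z) + z\<^sup>2 * (A - 1) * (M - 1)
        = z * ((z - 1) * (B - 1) + z * (A - 1) * (M - 1)) - (z - 1) * (B * z - A)"
      by (simp add: algebra_simps power2_eq_square)
    then have 1: "(z - 1) * (A - z) + z\<^sup>2 * (A - 1) * (M - 1) = 0" unfolding eq Bz by simp
    have "A * ((z - 1) * (A - z) * M + (A - 1) * (M - 1))
        = z * ((1 - z) * (1 - B) * A * M + B * (1 - A) * (1 - M))
          + (B * z - A) * ((1 - z) * A * M - (1 - A) * (1 - M))"
      by (simp add: algebra_simps)
    then have 2: "(z - 1) * (A - z) * M + (A - 1) * (M - 1) = 0" unfolding eq' Bz using nz by simp
    \<comment> \<open>Here the combination that factors yields
      \<open>z\<^sup>2 * M = 1\<close>.\<close>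
    have "(z - 1) * (A - z) * (z\<^sup>2 * M - 1) = z\<^sup>2 * ((z - 1) * (A - z) * M + (A - 1) * (M - 1))
        - ((z - 1) * (A - z) + z\<^sup>2 * (A - 1) * (M - 1))"
      by (simp add: algebra_simps)
    then have "(z - 1) * (A - z) * (z\<^sup>2 * M - 1) = 0" unfolding 1 2 by simp
    then have M: "z\<^sup>2 * M - 1 = 0" using ne by simp
    have "(z - 1) * (A * z - 1) = (A - 1) * (z\<^sup>2 * M - 1) - ((z - 1) * (A - z) + z\<^sup>2 * (A - 1) * (M - 1))"
      by (simp add: algebra_simps power2_eq_square)
    then have "(z - 1) * (A * z - 1) = 0" unfolding 1 M by simp
    then show False using ne by simp
  qed
qed

text \<open>With \<open>n = a * m + b\<close> and \<open>z^a\<close> equal to \<open>z\<close> or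
  \<open>1 / z\<close>, the power \<open>z^n\<close> becomes \<open>z^m * z^b\<close> or
  \<open>z^b / z^m\<close>, and the sparse form of the denominator collapses to a unit times
  \<open>(z - 1) * (z^n - 1)\<close>.\<close>

lemma denom_roots_of_unity_iff:
  fixes z :: complex
  assumes z: "z \<noteq> 1" "z ^ (a - 1) = 1 \<or> z ^ (a + 1) = 1"
    and b: "b = 1 \<or> b = a - 1" and a: "2 \<le> a"
  shows "poly (of_int_poly (denom a b m)) z = 0 \<longleftrightarrow> z ^ (a * m + b) = 1"
proof -
  define A where "A = z ^ a"
  define B where "B = z ^ b"
  define M where "M = z ^ m"
  have z0: "z \<noteq> 0" using z a by (auto simp: power_0_left)
  then have nz: "A \<noteq> 0" "B \<noteq> 0" "M \<noteq> 0" by (auto simp: A_def B_def M_def)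
  have root: "poly (of_int_poly (denom a b m)) z = 0 \<longleftrightarrow> (z - 1) * (B - 1) + z * (A - 1) * (M - 1) = 0"
    using poly_denom_mult[of z a b m] z(1) by (auto simp: A_def B_def M_def)
  have pow: "z ^ (a * m + b) = A ^ m * B" by (simp add: A_def B_def power_add power_mult)
  have B: "B = z \<or> B * z = A"
    using b a power_minus_mult[of a z] by (auto simp: A_def B_def)
  have "A = z \<or> A * z = 1"
    using z(2) z0 a power_pred_eq_1_iff[of a z] by (auto simp: A_def mult.commute)
  then show ?thesis
  proof
    assume A: "A = z"
    \<comment> \<open>The alternatives belong to \<open>B = z\<close> and
      \<open>B = 1\<close>.\<close>
    have "(z - 1) * (B - 1) + z * (A - 1) * (M - 1) = (z - 1) * (M * B - 1) \<or>
          (z - 1) * (B - 1) + z * (A - 1) * (M - 1) = z * (z - 1) * (M * B - 1)"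
      using B nz A z0 by (auto simp: algebra_simps)
    moreover have "A ^ m = M" by (simp add: A M_def)
    ultimately show ?thesis using root pow z(1) z0 by auto
  next
    assume A: "A * z = 1"
    have "A ^ m * M = 1" using A by (simp add: M_def flip: power_mult_distrib)
    then have "z ^ (a * m + b) = 1 \<longleftrightarrow> M = B"
      using pow nz by (metis mult.commute mult.left_commute mult.right_neutral mult_cancel_left)
    moreover have "(z - 1) * (B - 1) + z * (A - 1) * (M - 1) = (z - 1) * (B - M) + (A * z - 1) * (M - 1)"
      by (simp add: algebra_simps)
    then have "(z - 1) * (B - 1) + z * (A - 1) * (M - 1) = (z - 1) * (B - M)" using A by simp
    ultimately show ?thesis using root z(1) by auto
  qed
qed

lemma linear_ne_0:
  fixes z :: complex
  assumes "norm z = 1" "\<bar>p\<bar> \<noteq> \<bar>q\<bar>"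
  shows "of_real p * z + of_real q \<noteq> 0"
proof
  assume "of_real p * z + of_real q = 0"
  then have "of_real p * z = - of_real q" by (simp only: eq_neg_iff_add_eq_0)
  from arg_cong[OF this, of norm] show False using assms by (simp add: norm_mult)
qed

lemma norm_root_of_unity:
  fixes z :: complex
  assumes "z ^ k = 1" "0 < k"
  shows "norm z = 1"
proof -
  have "norm z ^ k = 1 ^ k" using assms(1) by (metis norm_one norm_power power_one)
  then show ?thesis using assms(2) by (intro power_eq_imp_eq_base[of "norm z" k 1]) auto
qed

text \<open>In each of four cases the root equation turns the derivative equation into
  \<open>(z - 1) * (p * z + q) = 0\<close> with real \<open>p\<close>, \<open>q\<close> of different
  absolute value. As \<open>z\<close> lies on the unit circle, \<open>linear_ne_0\<close> excludes
  this.\<close>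

lemma denom_simple_root:
  fixes z :: complex
  assumes z: "z \<noteq> 1" "z ^ (a - 1) = 1 \<or> z ^ (a + 1) = 1"
    and b: "b = 1 \<or> b = a - 1" and a: "2 \<le> a" and m: "a + 2 < m"
    and root: "poly (of_int_poly (denom a b m)) z = 0"
  shows "poly (of_int_poly (pderiv (denom a b m))) z \<noteq> 0"
proof
  assume der: "poly (of_int_poly (pderiv (denom a b m))) z = 0"
  define A where "A = z ^ a"
  define B where "B = z ^ b"
  define M where "M = z ^ m"
  have z0: "z \<noteq> 0" using z a by (auto simp: power_0_left)
  have norm: "norm z = 1" using z(2) a norm_root_of_unity[of z "a - 1"] norm_root_of_unity[of z "a + 1"] by auto
  have eq: "(z - 1) * (B - 1) + z * (A - 1) * (M - 1) = 0"
    using poly_denom_mult[of z a b m] root by (simp add: A_def B_def M_def)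
  have D: "z * (B - 1) + (z - 1) * of_nat b * B + z * (A - 1) * (M - 1)
      + z * of_nat a * A * (M - 1) + z * (A - 1) * of_nat m * M = 0"
    using poly_pderiv_denom[OF root] der a b m by (auto simp: A_def B_def M_def)
  have "A = z \<or> A * z = 1"
    using z(2) z0 a power_pred_eq_1_iff[of a z] by (auto simp: A_def mult.commute)
  moreover have "B = z \<and> b = 1 \<or> B * z = A \<and> b = a - 1"
    using b a power_minus_mult[of a z] by (auto simp: A_def B_def)
  ultimately consider "A = z" "B = z" "b = 1" | "A * z = 1" "B = z" "b = 1"
    | "A = z" "B * z = A" "b = a - 1" | "A * z = 1" "B * z = A" "b = a - 1" by blast
  then show False
  proof cases
    case 1
    have "(z - 1) * (z * M - 1) = (z - 1) * (B - 1) + z * (A - 1) * (M - 1)"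
      unfolding 1 by (simp add: algebra_simps)
    then have zM: "z * M - 1 = 0" using eq z(1) by simp
    have "(z - 1) * ((1 - of_nat a) * z + (1 + of_nat m)) =
        (z * (B - 1) + (z - 1) * of_nat b * B + z * (A - 1) * (M - 1)
          + z * of_nat a * A * (M - 1) + z * (A - 1) * of_nat m * M)
        - (z * M - 1) * ((z - 1) + of_nat a * z + of_nat m * (z - 1))"
      unfolding 1 of_nat_1 by (simp add: algebra_simps)
    then have "(1 - of_nat a) * z + (1 + of_nat m) = 0" unfolding D zM using z(1) by simp
    then show False using linear_ne_0[OF norm, of "1 - real a" "1 + real m"] a m by simp
  next
    case 2
    then have Az: "A * z - 1 = 0" by simp
    have "(z - 1) * (M - z) = (A * z - 1) * (M - 1) - ((z - 1) * (B - 1) + z * (A - 1) * (M - 1))"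
      unfolding 2(2) by (simp add: algebra_simps)
    then have M: "M = z" unfolding Az eq using z(1) by simp
    have "(z - 1) * ((1 - of_nat m) * z + (1 + of_nat a)) =
        (z * (B - 1) + (z - 1) * of_nat b * B + z * (A - 1) * (M - 1)
          + z * of_nat a * A * (M - 1) + z * (A - 1) * of_nat m * M)
        - (A * z - 1) * ((z - 1) + of_nat a * (z - 1) + of_nat m * z)"
      unfolding 2(2,3) M of_nat_1 by (simp add: algebra_simps)
    then have "(1 - of_nat m) * z + (1 + of_nat a) = 0" unfolding D Az using z(1) by simp
    \<comment> \<open>This case compares \<open>m - 1\<close> with \<open>a + 1\<close>, which the
      bound \<open>a + 2 < m\<close> keeps apart.\<close>
    then show False using linear_ne_0[OF norm, of "1 - real m" "1 + real a"] a m by simp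
  next
    case 3
    then have B: "B = 1" using z0 by simp
    have M: "M = 1" using eq z(1) z0 unfolding 3(1) B by simp
    have "(z - 1) * (of_nat m * z + of_nat b) = 0"
      using D unfolding 3(1) B M by (simp add: algebra_simps)
    then show False using z(1) linear_ne_0[OF norm, of "real m" "real b"] a m 3(3) by simp
  next
    case 4
    then have Az: "A * z - 1 = 0" by simp
    have Bz: "z\<^sup>2 * B - 1 = 0" using 4(1) unfolding 4(2)[symmetric] by (simp add: power2_eq_square mult_ac)
    have "(z - 1) * (z\<^sup>2 * M - 1) = (z\<^sup>2 * B - 1) * (z - 1) + z\<^sup>2 * (A * z - 1) * (M - 1)
        - z\<^sup>2 * ((z - 1) * (B - 1) + z * (A - 1) * (M - 1))"
      by (simp add: algebra_simps power2_eq_square)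
    then have M: "z\<^sup>2 * M - 1 = 0" unfolding Az Bz eq using z(1) by simp
    have b': "(of_nat b :: complex) = of_nat a - 1" using 4(3) a by (simp add: of_nat_diff)
    have "(z - 1) * ((of_nat a + 1) * z + (of_nat m + 2)) =
        (z\<^sup>2 * B - 1) * (z + (z - 1) * of_nat b)
        + (z\<^sup>2 * M - 1) * ((1 - z) + of_nat a + of_nat m * (1 - z))
        + (A * z - 1) * ((1 + of_nat a) * (z\<^sup>2 * M - z\<^sup>2) + of_nat m * z\<^sup>2 * M)
        - z\<^sup>2 * (z * (B - 1) + (z - 1) * of_nat b * B + z * (A - 1) * (M - 1)
          + z * of_nat a * A * (M - 1) + z * (A - 1) * of_nat m * M)"
      unfolding b' by (simp add: algebra_simps power2_eq_square)
    then have "(of_nat a + 1) * z + (of_nat m + 2) = 0" unfolding D Az Bz M using z(1) by simp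
    then show False using linear_ne_0[OF norm, of "real a + 1" "real m + 2"] a m by simp
  qed
qed

section \<open>Computation of the denominators\<close>

lemma qnum_Suc: "qnum (Suc k) = qnum k + monom 1 k"
  by (simp add: qnum_def)

lemma qnum_Suc': "qnum (Suc k) = 1 + monom 1 1 * qnum k"
  unfolding qnum_def by (subst sum.lessThan_Suc_shift) (simp add: sum_distrib_left mult_monom one_pCons monom_0)

lemma qnum_0 [simp]: "qnum 0 = 0" and qnum_1 [simp]: "qnum (Suc 0) = 1"
  by (simp_all add: qnum_def one_pCons monom_0)

lemma qvar_power: "qvar ^ k = to_fract (monom 1 k)"
proof (induction k)
  case 0
  show ?case by (simp add: monom_0 flip: one_pCons)
next
  case (Suc k)
  have "qvar ^ Suc k = to_fract (monom 1 1 * monom 1 k)"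
    by (simp only: power_Suc Suc.IH to_fract_mult)
  then show ?case by (simp add: mult_monom)
qed

lemma qvar_nonzero [simp]: "qvar \<noteq> 0"
  by (simp add: monom_eq_0_iff)

section \<open>First columns of the matrix products\<close>

lemma R_mat_power:
  "R_mat ^\<^sub>m c = mat_of_rows_list 2 [[qvar ^ c, to_fract (qnum c)], [0, 1]]"
proof (induction c)
  case 0
  show ?case by (rule eq_matI) (auto simp: R_mat_def mat_of_rows_list_def numeral_2_eq_2 less_Suc_eq)
next
  case (Suc c)
  have "R_mat ^\<^sub>m Suc c = mat_of_rows_list 2 [[qvar ^ c, to_fract (qnum c)], [0, 1]] * R_mat"
    by (simp add: Suc.IH)
  also have "\<dots> = mat_of_rows_list 2 [[qvar ^ Suc c, to_fract (qnum (Suc c))], [0, 1]]"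
    by (rule eq_matI) (auto simp: R_mat_def mat_of_rows_list_def numeral_2_eq_2 less_Suc_eq scalar_prod_def
        qnum_Suc qvar_power[unfolded One_nat_def] add.commute)
  finally show ?case .
qed

lemma R_S_mat:
  assumes "0 < c"
  shows "R_mat ^\<^sub>m c * S_mat = mat_of_rows_list 2 [[to_fract (qnum c), - (qvar ^ (c - 1))], [1, 0]]"
proof -
  have "qvar ^ c * inverse qvar = qvar ^ (c - 1)"
    unfolding power_minus_mult[OF assms, of qvar, symmetric] by (simp add: mult.assoc)
  then show ?thesis
    unfolding R_mat_power
    by (intro eq_matI) (auto simp: S_mat_def mat_of_rows_list_def numeral_2_eq_2 less_Suc_eq scalar_prod_def)
qed

lemma M_mat_carrier: "M_mat cs \<in> carrier_mat 2 2"
proof (induction cs)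
  case (Cons c cs)
  have "R_mat \<in> carrier_mat 2 2" "S_mat \<in> carrier_mat 2 2"
    by (auto simp: R_mat_def S_mat_def mat_of_rows_list_def)
  then show ?case using Cons by (auto intro!: mult_carrier_mat[of _ 2 2] pow_carrier_mat)
qed simp

lemma M_mat_Cons:
  assumes "0 < c"
  shows "M_mat (c # cs) $$ (0, 0) = to_fract (qnum c) * M_mat cs $$ (0, 0) - qvar ^ (c - 1) * M_mat cs $$ (1, 0)"
    and "M_mat (c # cs) $$ (1, 0) = M_mat cs $$ (0, 0)"
  using M_mat_carrier[of cs]
  by (auto simp: R_S_mat[OF assms] mat_of_rows_list_def scalar_prod_def numeral_2_eq_2)

text \<open>Prepending a 2 moves the upper entry down and multiplies the difference of the two
  entries by \<open>q\<close>; summing these differences produces the q-integer.\<close>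

lemma M_mat_twos:
  assumes "M_mat cs $$ (0, 0) = to_fract p" "M_mat cs $$ (1, 0) = to_fract r"
  shows "M_mat (replicate m 2 @ cs) $$ (0, 0) = to_fract (p + monom 1 1 * (p - r) * qnum m) \<and>
    M_mat (replicate m 2 @ cs) $$ (1, 0) = to_fract (r + (p - r) * qnum m)"
proof (induction m)
  case 0
  then show ?case using assms by simp
next
  case (Suc m)
  let ?X = "monom 1 1 :: int poly"
  have q2: "qnum 2 = 1 + ?X"
    using qnum_Suc'[of 1] by (simp add: numeral_2_eq_2)
  have "(1 + ?X) * (p + ?X * (p - r) * qnum m) - ?X * (r + (p - r) * qnum m)
      = p + ?X * (p - r) * (1 + ?X * qnum m)"
    by (simp add: algebra_simps)
  then have "to_fract (1 + ?X) * to_fract (p + ?X * (p - r) * qnum m) - qvar * to_fract (r + (p - r) * qnum m)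
      = to_fract (p + ?X * (p - r) * qnum (Suc m))"
    by (simp only: qnum_Suc' flip: to_fract_mult to_fract_diff)
  moreover have "r + (p - r) * (1 + ?X * qnum m) = p + ?X * (p - r) * qnum m"
    by (simp add: algebra_simps)
  ultimately show ?case
    using Suc.IH M_mat_Cons[of 2 "replicate m 2 @ cs"] by (simp add: q2 qnum_Suc')
qed

section \<open>Hirzebruch-Jung expansions\<close>

lemma hj_value_bounds:
  assumes "cs \<noteq> []" "\<forall>c\<in>set cs. 2 \<le> c"
  shows "1 < hj_value cs \<and> of_nat (hd cs) - 1 < hj_value cs \<and> hj_value cs \<le> of_nat (hd cs)"
  using assms
proof (induction cs rule: hj_value.induct)
  case (1 c)
  then show ?case by simp
next
  case (2 c d cs)
  then have v: "1 < hj_value (d # cs)" by simp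
  then have "0 < 1 / hj_value (d # cs)" "1 / hj_value (d # cs) < 1" by simp_all
  moreover have "(2 :: rat) \<le> of_nat c" using 2(3) by simp
  ultimately show ?case unfolding hj_value.simps list.sel by linarith
qed simp

text \<open>By \<open>hj_value_bounds\<close> the head is the ceiling of the value. A nonempty tail
  has value above 1, so its reciprocal is nonzero and the end of the list is detected too.\<close>

lemma hj_value_inj:
  assumes "cs \<noteq> []" "\<forall>c\<in>set cs. 2 \<le> c" "ds \<noteq> []" "\<forall>c\<in>set ds. 2 \<le> c"
    and "hj_value cs = hj_value ds"
  shows "cs = ds"
  using assms
proof (induction cs arbitrary: ds rule: hj_value.induct)
  case (1 c)
  obtain d ds' where ds: "ds = d # ds'" using 1 by (cases ds) auto
  have "(of_nat c :: rat) - 1 < of_nat d" "(of_nat d :: rat) - 1 < of_nat c"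
    using hj_value_bounds[OF 1(1,2)] hj_value_bounds[OF 1(3,4)] 1(5) unfolding ds list.sel by linarith+
  then have "c < d + 1" "d < c + 1"
    by (simp_all add: less_diff_eq diff_less_eq flip: of_nat_less_iff[where 'a = rat])
  then have "c = d" by simp
  show ?case
  proof (cases ds')
    case (Cons e es)
    then have "1 < hj_value ds'" using hj_value_bounds[of ds'] 1 ds by simp
    then show ?thesis using 1(5) ds Cons \<open>c = d\<close> by simp
  qed (simp add: ds \<open>c = d\<close>)
next
  case (2 c c' cs)
  obtain d ds' where ds: "ds = d # ds'" using 2 by (cases ds) auto
  have "(of_nat c :: rat) - 1 < of_nat d" "(of_nat d :: rat) - 1 < of_nat c"
    using hj_value_bounds[OF 2(2,3)] hj_value_bounds[OF 2(4,5)] 2(6) unfolding ds list.sel by linarith+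
  then have "c < d + 1" "d < c + 1"
    by (simp_all add: less_diff_eq diff_less_eq flip: of_nat_less_iff[where 'a = rat])
  then have cd: "c = d" by simp
  have v: "1 < hj_value (c' # cs)" using hj_value_bounds[of "c' # cs"] 2(3) by simp
  show ?case
  proof (cases ds')
    case Nil
    then show ?thesis using 2(6) ds cd v by simp
  next
    case (Cons e es)
    then have "1 < hj_value ds'" using hj_value_bounds[of ds'] 2(5) ds by simp
    then have "hj_value (c' # cs) = hj_value ds'"
      using 2(6) ds Cons cd v by simp
    then show ?thesis using 2(1)[of ds'] 2(3,5) ds Cons cd by simp
  qed
qed simp

lemma hj_expansion_eqI:
  assumes "cs \<noteq> []" "\<forall>c\<in>set cs. 2 \<le> c" "hj_value cs = x"
  shows "hj_expansion x = cs"
  unfolding hj_expansion_def using assms hj_value_inj by (intro the_equality) blast+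

text \<open>Each prepended 2 adds \<open>d\<close> to numerator and denominator:
  \<open>2 - y / (y + d) = (y + 2 d) / (y + d)\<close>.\<close>

lemma hj_value_twos:
  assumes "cs \<noteq> []" "hj_value cs = of_nat (y + d) / of_nat y" "0 < y"
  shows "hj_value (replicate m 2 @ cs) = of_nat (y + d + m * d) / of_nat (y + m * d)"
proof (induction m)
  case (Suc m)
  obtain e es where es: "replicate m 2 @ cs = e # es" using assms(1) by (cases "replicate m 2 @ cs") auto
  have "(of_nat (y + d + m * d) :: rat) \<noteq> 0" using assms(3) by (simp only: of_nat_eq_0_iff)
  then show ?case using Suc assms(3) unfolding replicate_Suc append_Cons es
    by (simp add: field_simps)
qed (use assms in simp)

lemma q_rational_le_1:
  assumes "x \<le> 1" "0 < x" "cs \<noteq> []" "\<forall>c\<in>set cs. 2 \<le> c" "hj_value cs = x + 1"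
  shows "q_rational x = (M_mat cs $$ (0, 0) / M_mat cs $$ (1, 0) - 1) / qvar"
  using assms hj_expansion_eqI[OF assms(3-5)]
  by (subst q_rational.simps, simp, subst q_rational.simps) (simp add: Let_def)

section \<open>Laurent polynomials and uniqueness of the reduced denominator\<close>

lemma to_fract_laurent [intro, simp]: "to_fract p \<in> laurent_polys"
  unfolding laurent_polys_def by (rule CollectI, rule exI[of _ p], rule exI[of _ 0]) simp

lemma laurent_mult:
  assumes "f \<in> laurent_polys" "g \<in> laurent_polys"
  shows "f * g \<in> laurent_polys"
proof -
  obtain p k r l where "f = to_fract p / qvar ^ k" "g = to_fract r / qvar ^ l"
    using assms by (auto simp: laurent_polys_def)
  then have "f * g = to_fract (p * r) / qvar ^ (k + l)"
    by (simp only: power_add to_fract_mult times_divide_times_eq)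
  then show ?thesis unfolding laurent_polys_def by blast
qed

lemma laurent_add:
  assumes "f \<in> laurent_polys" "g \<in> laurent_polys"
  shows "f + g \<in> laurent_polys"
proof -
  obtain p k r l where fg: "f = to_fract p / qvar ^ k" "g = to_fract r / qvar ^ l"
    using assms by (auto simp: laurent_polys_def)
  have nz: "qvar ^ k \<noteq> 0" "qvar ^ l \<noteq> 0" by (simp_all only: power_not_zero qvar_nonzero not_False_eq_True)
  have "f + g = to_fract (p * monom 1 l + r * monom 1 k) / qvar ^ (k + l)"
    unfolding fg add_frac_eq[OF nz] by (simp only: power_add to_fract_add to_fract_mult qvar_power)
  then show ?thesis unfolding laurent_polys_def by blast
qed

text \<open>Since \<open>q\<close> does not divide \<open>r\<close>, the power of \<open>q\<close>
  in the denominator of \<open>h\<close> has to divide the numerator of \<open>h\<close>.\<close>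

lemma dvd_if_laurent_multiple:
  assumes "to_fract p = to_fract r * h" "h \<in> laurent_polys" "poly r 0 \<noteq> 0"
  shows "r dvd p"
proof -
  obtain s k where h: "h = to_fract s / qvar ^ k" using assms(2) by (auto simp: laurent_polys_def)
  have nz: "qvar ^ k \<noteq> 0" by (simp only: power_not_zero qvar_nonzero not_False_eq_True)
  have "to_fract p * qvar ^ k = to_fract r * to_fract s"
    unfolding assms(1) h using nz by simp
  then have "to_fract (p * monom 1 k) = to_fract (r * s)"
    by (simp only: to_fract_mult qvar_power)
  then have eq: "p * monom 1 k = r * s" by (simp only: to_fract_eq_iff)
  show ?thesis
  proof (cases "s = 0")
    case True
    then have "p = 0" using eq by (simp add: monom_eq_0_iff)
    then show ?thesis by simp
  next
    case False
    have "r \<noteq> 0" using assms(3) by auto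
    then have rs: "r * s \<noteq> 0" using False by simp
    have "monom 1 k dvd r * s" unfolding eq[symmetric] by simp
    then have "k \<le> order 0 (r * s)" using rs by (simp add: monom_1_dvd_iff)
    also have "order 0 (r * s) = order 0 s"
      using order_mult[OF rs] assms(3) by (simp add: order_0I)
    finally have "monom 1 k dvd s" using False by (simp add: monom_1_dvd_iff)
    then obtain t where "s = monom 1 k * t" by (elim dvdE)
    then have "monom 1 k * p = monom 1 k * (r * t)" using eq by (simp add: mult_ac)
    then show ?thesis by (simp add: monom_eq_0_iff)
  qed
qed

text \<open>
  A Bezout identity in the Laurent ring makes the reduced fraction unique up to a unit \<open>t\<close>.
\<close>

lemma q_denominator_eqI:
  assumes x: "q_rational x = to_fract (monom 1 m * A) / to_fract S"
    and bez: "U * A + V * S = 1" and S0: "poly S 0 = 1"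
  shows "q_denominator x = S"
proof -
  define R where "R = to_fract (monom 1 m * A)"
  \<comment> \<open>Dividing by \<open>q^m\<close> turns the Bezout identity for \<open>A\<close>
    and \<open>S\<close> into one for \<open>R\<close> and \<open>S\<close>.\<close>
  define u where "u = to_fract U / qvar ^ m"
  define v where "v = to_fract V"
  have "u \<in> laurent_polys" unfolding u_def laurent_polys_def by blast
  then have laurent: "R \<in> laurent_polys" "u \<in> laurent_polys" "v \<in> laurent_polys" "to_fract S \<in> laurent_polys"
    unfolding R_def v_def by (simp_all only: to_fract_laurent)
  have nz: "qvar ^ m \<noteq> 0" by (simp only: power_not_zero qvar_nonzero not_False_eq_True)
  have "R = qvar ^ m * to_fract A" unfolding R_def by (simp only: to_fract_mult qvar_power)
  moreover have "f / h * (h * g) = f * g" if "h \<noteq> 0" for f g h :: "int poly fract"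
    using that by simp
  ultimately have "u * R = to_fract (U * A)"
    using nz unfolding u_def to_fract_mult by blast
  then have uv: "u * R + v * to_fract S = 1"
    using arg_cong[OF bez, of to_fract] by (simp only: v_def to_fract_add to_fract_mult to_fract_1)
  have S: "to_fract S \<noteq> 0" using S0 by auto
  have frac: "q_fraction x R S"
    unfolding q_fraction_def
  proof (intro conjI)
    show "laurent_coprime R (to_fract S)"
      unfolding laurent_coprime_def
    proof (intro ballI impI)
      fix h assume "laurent_dvd h R" "laurent_dvd h (to_fract S)"
      then obtain r s where rs: "r \<in> laurent_polys" "R = h * r" "s \<in> laurent_polys" "to_fract S = h * s"
        unfolding laurent_dvd_def by blast
      have "1 = h * (u * r + v * s)" using uv unfolding rs(2,4) by (simp add: algebra_simps)
      moreover have "u * r + v * s \<in> laurent_polys" using laurent rs by (intro laurent_add laurent_mult)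
      ultimately show "laurent_dvd h 1" unfolding laurent_dvd_def by blast
    qed
  qed (use laurent x S0 in \<open>simp_all add: R_def\<close>)
  show ?thesis
    unfolding q_denominator_def
  proof (rule the_equality)
    show "\<exists>R. q_fraction x R S" using frac by blast
    fix S' assume "\<exists>R'. q_fraction x R' S'"
    then obtain R' where R': "R' \<in> laurent_polys" "laurent_coprime R' (to_fract S')"
      "q_rational x = R' / to_fract S'" "poly S' 0 = 1"
      unfolding q_fraction_def by blast
    have S': "to_fract S' \<noteq> 0" using R'(4) by auto
    have cross: "R' * to_fract S = R * to_fract S'"
      using R'(3) x S S' by (simp add: R_def frac_eq_eq)
    \<comment> \<open>By Bezout this is the common factor with \<open>S' = S * t\<close> and
      \<open>R' = R * t\<close>; coprimality of the second pair makes it a unit.\<close>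
    define t where "t = u * R' + v * to_fract S'"
    have t: "t \<in> laurent_polys" using laurent R' by (auto simp: t_def intro!: laurent_add laurent_mult)
    have "to_fract S' = (u * R + v * to_fract S) * to_fract S'" by (simp only: uv mult_1_left)
    also have "\<dots> = u * (R * to_fract S') + v * to_fract S * to_fract S'" by (simp only: algebra_simps)
    also have "\<dots> = to_fract S * t" unfolding cross[symmetric] t_def by (simp only: algebra_simps)
    finally have S't: "to_fract S' = to_fract S * t" .
    have "R' = (u * R + v * to_fract S) * R'" by (simp only: uv mult_1_left)
    also have "\<dots> = u * R * R' + v * (R' * to_fract S)" by (simp only: algebra_simps)
    also have "\<dots> = R * t" unfolding cross t_def by (simp only: algebra_simps)
    finally have R't: "R' = R * t" .
    have "laurent_dvd t R'" "laurent_dvd t (to_fract S')"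
      unfolding laurent_dvd_def using laurent S't R't by (auto simp: mult.commute)
    then have "laurent_dvd t 1" using R'(2) t unfolding laurent_coprime_def by blast
    then obtain h where h: "h \<in> laurent_polys" "1 = t * h" unfolding laurent_dvd_def by blast
    \<comment> \<open>Nonzero constant terms upgrade divisibility to integer polynomials in both
      directions. The quotient is then a constant, and the normalisation at 0 makes it 1.\<close>
    have "to_fract S = to_fract S' * h" unfolding S't mult.assoc h(2)[symmetric] by simp
    then have "S' dvd S" by (rule dvd_if_laurent_multiple) (use h R' in auto)
    then obtain c where c: "S = S' * c" by (elim dvdE)
    have "S dvd S'" by (rule dvd_if_laurent_multiple[OF S't t]) (use S0 in auto)
    then obtain d where d: "S' = S * d" by (elim dvdE)
    have "S \<noteq> 0" using S0 by auto
    moreover have "S * (d * c) = S * 1" using c d by (metis mult.assoc mult.right_neutral)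
    ultimately have "d * c = 1" by (simp only: mult_cancel_left) simp
    then have "c dvd 1" by (metis dvd_triv_right)
    then obtain c' where "c = [:c':]" by (auto simp: is_unit_poly_iff)
    moreover have "poly c 0 = 1" using arg_cong[OF c, of "\<lambda>p. poly p 0"] S0 R'(4) by simp
    ultimately have "c = 1" by (simp add: one_pCons)
    then show "S' = S" using c by simp
  qed
qed

lemma poly_qnum_0: "0 < k \<Longrightarrow> poly (qnum k) 0 = 1"
  using qnum_Suc'[of "k - 1"] by (simp add: poly_monom)

text \<open>Here \<open>cs\<close> expands \<open>(b + a) / b\<close>. With \<open>m\<close> twos in
  front the value is \<open>a / (a * m + b) + 1\<close>, and one translation step back reaches the
  required fraction.\<close>

lemma q_denominator_twos:
  assumes cs: "cs \<noteq> []" "\<forall>c\<in>set cs. 2 \<le> c" "hj_value cs = of_nat (b + a) / of_nat b" "0 < b" "0 < a"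
    and M: "M_mat cs $$ (0, 0) = to_fract (qnum b + monom 1 1 * qnum a)" "M_mat cs $$ (1, 0) = to_fract (qnum b)"
    and bez: "U * qnum a + V * denom a b m = 1" and m: "0 < m"
  shows "q_denominator (of_nat a / of_nat (a * m + b)) = denom a b m"
proof (rule q_denominator_eqI[OF _ bez])
  let ?X = "monom 1 1 :: int poly"
  let ?cs = "replicate m 2 @ cs"
  show S0: "poly (denom a b m) 0 = 1"
    using assms(4) by (simp add: denom_def poly_qnum_0 poly_monom)
  then have S: "to_fract (denom a b m) \<noteq> 0" by auto
  \<comment> \<open>The upper entry exceeds the lower one by \<open>q * q^m * [a]\<close>;
    subtracting 1 from the quotient and dividing by \<open>q\<close> leaves \<open>q^m * [a]\<close>
    over the denominator.\<close>
  have R: "qnum b + ?X * qnum a + ?X * (?X * qnum a) * qnum m = denom a b m + ?X * (monom 1 m * qnum a)"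
  proof -
    have "?X * qnum m - qnum m = monom 1 m - 1" using qnum_mult[of m] by (simp add: algebra_simps)
    then have X: "?X * qnum m = qnum m + monom 1 m - 1" by (simp add: algebra_simps)
    have "qnum b + ?X * qnum a + ?X * (?X * qnum a) * qnum m = qnum b + ?X * qnum a + ?X * qnum a * (?X * qnum m)"
      by (simp only: mult_ac)
    then show ?thesis unfolding X denom_def by (simp add: algebra_simps)
  qed
  have M': "M_mat ?cs $$ (0, 0) = to_fract (denom a b m) + qvar * to_fract (monom 1 m * qnum a)"
    "M_mat ?cs $$ (1, 0) = to_fract (denom a b m)"
    using M_mat_twos[OF M, of m] R
    by (simp_all only: add_diff_cancel_left' to_fract_add[symmetric] to_fract_mult[symmetric] denom_def mult.assoc)
  have x1: "hj_value ?cs = of_nat a / of_nat (a * m + b) + 1"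
  proof -
    have "(of_nat (a * m + b) :: rat) \<noteq> 0" using assms(4) by (simp only: of_nat_eq_0_iff)
    moreover have "b + a + m * a = a + (a * m + b)" "b + m * a = a * m + b" by simp_all
    then have "hj_value ?cs = (of_nat a + of_nat (a * m + b)) / of_nat (a * m + b)"
      using hj_value_twos[OF cs(1,3,4), of m] by (simp only: of_nat_add)
    ultimately show ?thesis by (simp only: add_divide_distrib divide_self not_False_eq_True)
  qed
  have "q_rational (of_nat a / of_nat (a * m + b)) = (M_mat ?cs $$ (0, 0) / M_mat ?cs $$ (1, 0) - 1) / qvar"
  proof (rule q_rational_le_1[OF _ _ _ _ x1])
    have "a \<le> a * m + b" using m by (cases m) auto
    then show "(of_nat a / of_nat (a * m + b) :: rat) \<le> 1"
      using assms(4) by (simp add: divide_le_eq_1 flip: of_nat_add of_nat_mult)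
    show "0 < (of_nat a / of_nat (a * m + b) :: rat)" using assms(4,5) by (simp add: add_nonneg_pos)
  qed (use cs in auto)
  also have "\<dots> = to_fract (monom 1 m * qnum a) / to_fract (denom a b m)"
    unfolding M' using S qvar_nonzero by (simp only: add_divide_distrib) simp
  finally show "q_rational (of_nat a / of_nat (a * m + b)) = to_fract (monom 1 m * qnum a) / to_fract (denom a b m)" .
qed

lemma q_denominator_plus_1:
  assumes "2 \<le> a" "0 < m"
  shows "q_denominator (of_nat a / of_nat (a * m + 1)) = denom a 1 m"
proof (rule q_denominator_twos[where cs = "[a + 1]"])
  \<comment> \<open>For \<open>b = 1\<close> the denominator is \<open>1 + q [a] [m]\<close>, so the
    Bezout identity is immediate.\<close>
  show "- monom 1 1 * qnum m * qnum a + 1 * denom a 1 m = 1"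
    by (simp add: denom_def algebra_simps)
qed (use assms M_mat_Cons[of "a + 1" "[]"] in \<open>simp_all add: qnum_Suc'\<close>)

lemma q_denominator_minus_1:
  assumes "3 \<le> a" "0 < m"
  shows "q_denominator (of_nat a / of_nat (a * m + (a - 1))) = denom a (a - 1) m"
proof -
  let ?X = "monom 1 1 :: int poly"
  define a' where "a' = a - 3"
  then have a: "a = Suc (Suc (Suc a'))" using assms(1) by simp
  have X2: "qvar ^ 2 = to_fract (?X * ?X)" 
  proof -
    have "?X * ?X = monom 1 2" by (simp add: mult_monom numeral_2_eq_2)
    then show ?thesis by (simp only: qvar_power)
  qed
  have M0: "M_mat (replicate (a - 2) 2) $$ (0, 0) = to_fract (qnum (a - 1))"
    "M_mat (replicate (a - 2) 2) $$ (1, 0) = to_fract (qnum (a - 2))"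
    using M_mat_twos[of "[]" 1 0 "a - 2"] by (simp_all add: a qnum_Suc')
  have "qnum 3 * qnum (a - 1) - ?X * ?X * qnum (a - 2) = qnum (a - 1) + ?X * qnum a"
  proof -
    have 3: "qnum 3 = 1 + ?X * (1 + ?X)" by (simp add: numeral_3_eq_3 qnum_Suc')
    have 1: "qnum (a - 1) = 1 + ?X * qnum (a - 2)" and 0: "qnum a = 1 + ?X * qnum (a - 1)"
      by (simp_all add: a qnum_Suc')
    have "?X * ?X * qnum (a - 2) = ?X * (qnum (a - 1) - 1)" unfolding 1 by simp
    then show ?thesis unfolding 3 0 by (simp add: algebra_simps)
  qed
  then have eq: "to_fract (qnum 3) * to_fract (qnum (a - 1)) - qvar ^ 2 * to_fract (qnum (a - 2))
      = to_fract (qnum (a - 1) + ?X * qnum a)"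
    unfolding X2 by (simp only: to_fract_mult[symmetric] to_fract_diff[symmetric])
  have v0: "hj_value (replicate (a - 2) 2) = of_nat (a - 1) / of_nat (a - 2)"
    using hj_value_twos[of "[2]" 1 1 a'] by (simp add: a replicate_append_same)
  show ?thesis
  \<comment> \<open>The expansion comes from
    \<open>(2 a - 1) / (a - 1) = 3 - (a - 2) / (a - 1)\<close>; the Bezout identity below reduces to
    \<open>[a] - q [a - 1] = 1\<close>.\<close>
  proof (rule q_denominator_twos[where cs = "3 # replicate (a - 2) 2"])
    obtain e es where es: "replicate (a - 2) (2 :: nat) = e # es" by (simp add: a)
    have "hj_value (3 # replicate (a - 2) 2) = 3 - 1 / hj_value (replicate (a - 2) 2)"
      unfolding es by simp
    also have "\<dots> = 3 - of_nat (a - 2) / of_nat (a - 1)" unfolding v0 by simp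
    also have "\<dots> = of_nat (a - 1 + a) / of_nat (a - 1)" by (simp add: a field_simps)
    finally show "hj_value (3 # replicate (a - 2) 2) = of_nat (a - 1 + a) / of_nat (a - 1)" .
    show "M_mat (3 # replicate (a - 2) 2) $$ (0, 0) = to_fract (qnum (a - 1) + ?X * qnum a)"
      "M_mat (3 # replicate (a - 2) 2) $$ (1, 0) = to_fract (qnum (a - 1))"
      using M_mat_Cons[of 3 "replicate (a - 2) 2"] eq M0 by (simp_all only: zero_less_numeral) simp_all
    have "qnum a = 1 + ?X * qnum (a - 1)" by (simp add: a qnum_Suc')
    moreover have "(1 + ?X * ?X * qnum m) * qnum a + (- ?X) * denom a (a - 1) m = qnum a - ?X * qnum (a - 1)"
      by (simp add: denom_def algebra_simps)
    ultimately show "(1 + ?X * ?X * qnum m) * qnum a + (- ?X) * denom a (a - 1) m = 1" by simp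
  qed (use assms in auto)
qed

section \<open>Rigidity of the denominators\<close>

text \<open>Divisibility by \<open>W\<close> is part of the condition because it discards spurious
  solutions of the search when \<open>a = 3\<close>.\<close>

definition rigid :: "int poly \<Rightarrow> int poly \<Rightarrow> bool" where
  "rigid W F \<longleftrightarrow> (\<forall>H. W dvd H \<longrightarrow> degree H = degree F \<longrightarrow> H * reflect_poly H = F * reflect_poly F \<longrightarrow>
     H \<in> {F, - F, reflect_poly F, - reflect_poly F})"

lemma two_ended_uminus: "two_ended N (map uminus lo) (map uminus hi) = - two_ended N lo hi"
proof -
  have *: "Poly (map uminus xs) = - Poly xs" for xs :: "int list" by (induction xs) simp_all
  show ?thesis by (simp add: two_ended_def * rev_map)
qed

text \<open>The search returns lists with leading entry 1, whereas \<open>lo\<close> or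
  \<open>hi\<close> may begin with -1; hence the alternatives with \<open>uminus\<close>. Any other
  hit has to fail divisibility by \<open>W\<close>.\<close>

lemma rigid_two_ended:
  assumes cs: "completions (map (\<lambda>j. s * (\<Sum>i\<leftarrow>[0..<Suc j]. lo ! i * hi ! (j - i))) [1..<K]) b [] [] = cs"
    and len: "length lo = K" "length hi = K" "2 * K \<le> Suc N" "0 < K"
    and s: "hd lo * hd hi = s" "s \<in> {1, -1}"
    and b: "(\<Sum>x\<leftarrow>lo. x\<^sup>2) + (\<Sum>x\<leftarrow>hi. x\<^sup>2) = b + 2" "b < 9"
    and full: "\<forall>(L, U)\<in>set cs. (\<Sum>x\<leftarrow>L. x\<^sup>2) + (\<Sum>x\<leftarrow>U. x\<^sup>2) = b"
    and good: "\<forall>(L, U)\<in>set cs.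
      (1 # rev L = lo \<and> map ((*) s) (1 # rev U) = hi) \<or>
      (1 # rev L = hi \<and> map ((*) s) (1 # rev U) = lo) \<or>
      (1 # rev L = map uminus lo \<and> map ((*) s) (1 # rev U) = map uminus hi) \<or>
      (1 # rev L = map uminus hi \<and> map ((*) s) (1 # rev U) = map uminus lo) \<or>
      \<not> W dvd two_ended N (1 # rev L) (map ((*) s) (1 # rev U))"
  shows "rigid W (two_ended N lo hi)"
  unfolding rigid_def
proof (intro allI impI)
  fix H
  assume H: "W dvd H" "degree H = degree (two_ended N lo hi)"
    "H * reflect_poly H = two_ended N lo hi * reflect_poly (two_ended N lo hi)"
  have ne: "lo \<noteq> []" "hi \<noteq> []" using len by auto
  have hd0: "hd lo \<noteq> 0" "hd hi \<noteq> 0" using s by auto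
  have deg: "degree H = N" using H(2) degree_two_ended[of lo hi N] len ne hd0 by simp
  have full': "(\<Sum>x\<leftarrow>L. x\<^sup>2) + (\<Sum>x\<leftarrow>U. x\<^sup>2) = b" if "(L, U) \<in> set cs" for L U
    using bspec[OF full that] by simp
  obtain L U h where LU: "(L, U) \<in> set cs" and h: "h \<in> {1, -1}"
    and HLU: "H = smult h (two_ended N (1 # rev L) (map ((*) s) (1 # rev U)))"
    by (rule two_ended_rigidity[OF deg H(3) len s b cs full'])
  have refl: "reflect_poly (two_ended N lo hi) = two_ended N hi lo"
    using reflect_two_ended[of lo hi N] len ne hd0 by simp
  define l where "l = 1 # rev L"
  define u where "u = map ((*) s) (1 # rev U)"
  have H': "H = smult h (two_ended N l u)" using HLU by (simp only: l_def u_def)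
  have "W dvd two_ended N l u"
    using H(1) h unfolding H' by auto
  moreover have "l = lo \<and> u = hi \<or> l = hi \<and> u = lo \<or> l = map uminus lo \<and> u = map uminus hi \<or>
      l = map uminus hi \<and> u = map uminus lo \<or> \<not> W dvd two_ended N l u"
    using bspec[OF good LU] by (simp only: prod.case l_def u_def)
  ultimately have "two_ended N l u \<in>
      {two_ended N lo hi, two_ended N hi lo, - two_ended N lo hi, - two_ended N hi lo}"
    by (elim disjE conjE) (simp_all add: two_ended_uminus)
  then show "H \<in> {two_ended N lo hi, - two_ended N lo hi, reflect_poly (two_ended N lo hi),
      - reflect_poly (two_ended N lo hi)}"
    using h unfolding H' refl by auto
qed

lemma not_square_dvd:
  fixes p :: "int poly"
  assumes "poly (pderiv p) 1 \<noteq> 0"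
  shows "\<not> (monom 1 1 - 1)\<^sup>2 dvd p"
proof
  assume "(monom 1 1 - 1)\<^sup>2 dvd p"
  then obtain r where "p = (monom 1 1 - 1)\<^sup>2 * r" by (elim dvdE)
  then have "poly (pderiv p) 1 = 0"
    by (simp add: power2_eq_square pderiv_mult poly_monom)
  with assms show False by simp
qed

text \<open>Of the sparse form only \<open>q (q^a - 1) q^m\<close> lies at the top. A window of
  length \<open>2 a + 2\<close> starts at exponent \<open>m - a\<close>, which accounts for the
  factor \<open>monom 1 a\<close> in the description of \<open>hi\<close>.\<close>

lemma two_ended_denom:
  assumes "a \<le> m" "length hi = 2 * a + 2"
    and "Poly lo = (monom 1 1 - 1) * (monom 1 b - 1) - monom 1 1 * (monom 1 a - 1)"
    and "Poly (rev hi) = monom 1 1 * (monom 1 a - 1) * monom 1 a"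
  shows "(monom 1 1 - 1)\<^sup>2 * denom a b m = two_ended (m + a + 1) lo hi"
proof -
  have k: "Suc (m + a + 1) - length hi = m - a" using assms(1,2) by simp
  have m: "monom 1 m = monom 1 (m - a) * (monom 1 a :: int poly)"
    using assms(1) by (simp add: mult_monom)
  show ?thesis
    unfolding denom_mult two_ended_def assms(3,4) k unfolding m by (simp add: algebra_simps)
qed

lemma two_ended_denom_2:
  assumes "1 \<le> m"
  shows "(monom 1 1 - 1) * denom 2 1 m = two_ended (m + 2) [- 1, 0, - 1, 0] [1, 1, 0, 0]"
proof -
  let ?X = "monom 1 1 :: int poly"
  have q: "qnum 2 = 1 + ?X" "qnum 1 = 1" by (simp_all add: numeral_2_eq_2 qnum_Suc')
  have m: "monom 1 m = monom 1 (m - 1) * ?X" using assms by (simp add: mult_monom)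
  have "(?X - 1) * denom 2 1 m = (?X - 1) + ?X * (1 + ?X) * ((?X - 1) * qnum m)"
    unfolding denom_def q by (simp add: algebra_simps)
  also have "\<dots> = ((?X - 1) - ?X * (1 + ?X)) + monom 1 (m - 1) * (?X * ?X * (1 + ?X))"
    unfolding qnum_mult m by (simp add: algebra_simps)
  also have "(?X - 1) - ?X * (1 + ?X) = Poly [- 1, 0, - 1, 0]"
    by (simp add: monom_Suc monom_0 one_pCons)
  also have "?X * ?X * (1 + ?X) = Poly (rev [1, 1, 0, 0])"
    by (simp add: monom_Suc monom_0 one_pCons)
  finally show ?thesis by (simp add: two_ended_def)
qed

section \<open>Finite searches for the seven pairs (a, b)\<close>

text \<open>
  For \<open>a = 2\<close> the factor \<open>q - 1\<close> already leaves four terms; with \<open>(q - 1)^2\<close> the search would not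
  determine \<open>H\<close>. For \<open>a = 3\<close> the search has spurious solutions, none of which has a double zero at \<open>1\<close>.
\<close>

lemma rigid_2_1:
  assumes "10 \<le> m"
  shows "rigid (monom 1 1 - 1) ((monom 1 1 - 1) * denom 2 1 m)"
proof -
  let ?lo = "[-1, 0, -1, 0] :: int list" and ?hi = "[1, 1, 0, 0] :: int list"
  have F: "(monom 1 1 - 1) * denom 2 1 m = two_ended (m + 2) ?lo ?hi"
    using assms by (intro two_ended_denom_2) simp
  show ?thesis unfolding F
  \<comment> \<open>The four unit coefficients less the two outermost ones leave the budget 2; the
    outermost signs are opposite, so \<open>s = -1\<close>.\<close>
  proof (rule rigid_two_ended[where K = 4 and s = "-1" and b = 2])
    show "completions (map (\<lambda>j. -1 * (\<Sum>i\<leftarrow>[0..<Suc j]. ?lo ! i * ?hi ! (j - i))) [1..<4]) 2 [] [] =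
        [([0, 1, 0], [0, 0, 1]), ([0, 0, 1], [0, 1, 0])]"
      by code_simp
  qed (use assms in simp_all)
qed

lemma rigid_3_1:
  assumes "15 \<le> m"
  shows "rigid ((monom 1 1 - 1)\<^sup>2) (((monom 1 1 - 1)\<^sup>2) * denom 3 1 m)"
proof -
  let ?lo = "[1, -1, 1, 0, -1, 0, 0, 0] :: int list" and ?hi = "[1, 0, 0, -1, 0, 0, 0, 0] :: int list"
  have F: "(monom 1 1 - 1)\<^sup>2 * denom 3 1 m = two_ended (m + 4) ?lo ?hi"
    using assms two_ended_denom[of 3 m ?hi ?lo 1]
    by (simp add: numeral_eq_Suc monom_Suc monom_0 one_pCons)
  \<comment> \<open>These two polynomials are the spurious hits of the search below, mirror images
    of each other.\<close>
  have ex1: "\<not> (monom 1 1 - 1)\<^sup>2 dvd two_ended (m + 4) [1, -1, 0, 0, 0, 0, 0, 0] [1, 0, 1, 0, 0, -1, -1, 0]"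
    by (rule not_square_dvd)
      (simp add: two_ended_def pderiv_mult pderiv_add pderiv_diff pderiv_pCons pderiv_monom poly_monom)
  have ex2: "\<not> (monom 1 1 - 1)\<^sup>2 dvd two_ended (m + 4) [1, 0, 1, 0, 0, -1, -1, 0] [1, -1, 0, 0, 0, 0, 0, 0]"
    by (rule not_square_dvd)
      (simp add: two_ended_def pderiv_mult pderiv_add pderiv_diff pderiv_pCons pderiv_monom poly_monom)
  show ?thesis unfolding F
  \<comment> \<open>The window has length \<open>K = 2 * a + 2\<close>, and six unit coefficients
    less the two outermost ones leave the budget 4.\<close>
  proof (rule rigid_two_ended[where K = 8 and s = "1" and b = 4])
    show "completions (map (\<lambda>j. 1 * (\<Sum>i\<leftarrow>[0..<Suc j]. ?lo ! i * ?hi ! (j - i))) [1..<8]) 4 [] [] =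
        [([0, 0, 0, 0, 0, 0, -1], [0, -1, -1, 0, 0, 1, 0]), ([0, 0, 0, -1, 0, 1, -1], [0, 0, 0, 0, -1, 0, 0]), ([0, 0, 0, 0, -1, 0, 0], [0, 0, 0, -1, 0, 1, -1]), ([0, -1, -1, 0, 0, 1, 0], [0, 0, 0, 0, 0, 0, -1])]"
      by code_simp
  qed (use assms ex1 ex2 in simp_all)
qed

lemma rigid_3_2:
  assumes "15 \<le> m"
  shows "rigid ((monom 1 1 - 1)\<^sup>2) (((monom 1 1 - 1)\<^sup>2) * denom 3 2 m)"
proof -
  let ?lo = "[1, 0, -1, 1, -1, 0, 0, 0] :: int list" and ?hi = "[1, 0, 0, -1, 0, 0, 0, 0] :: int list"
  have F: "(monom 1 1 - 1)\<^sup>2 * denom 3 2 m = two_ended (m + 4) ?lo ?hi"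
    using assms two_ended_denom[of 3 m ?hi ?lo 2]
    by (simp add: numeral_eq_Suc monom_Suc monom_0 one_pCons)
  have ex1: "\<not> (monom 1 1 - 1)\<^sup>2 dvd two_ended (m + 4) [1, -1, 0, 0, 0, 0, 0, 0] [1, 1, 0, 0, -1, 0, -1, 0]"
    by (rule not_square_dvd)
      (simp add: two_ended_def pderiv_mult pderiv_add pderiv_diff pderiv_pCons pderiv_monom poly_monom)
  have ex2: "\<not> (monom 1 1 - 1)\<^sup>2 dvd two_ended (m + 4) [1, 1, 0, 0, -1, 0, -1, 0] [1, -1, 0, 0, 0, 0, 0, 0]"
    by (rule not_square_dvd)
      (simp add: two_ended_def pderiv_mult pderiv_add pderiv_diff pderiv_pCons pderiv_monom poly_monom)
  show ?thesis unfolding F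
  proof (rule rigid_two_ended[where K = 8 and s = "1" and b = 4])
    show "completions (map (\<lambda>j. 1 * (\<Sum>i\<leftarrow>[0..<Suc j]. ?lo ! i * ?hi ! (j - i))) [1..<8]) 4 [] [] =
        [([0, 0, 0, 0, 0, 0, -1], [0, -1, 0, -1, 0, 0, 1]), ([0, 0, 0, -1, 1, -1, 0], [0, 0, 0, 0, -1, 0, 0]), ([0, 0, 0, 0, -1, 0, 0], [0, 0, 0, -1, 1, -1, 0]), ([0, -1, 0, -1, 0, 0, 1], [0, 0, 0, 0, 0, 0, -1])]"
      by code_simp
  qed (use assms ex1 ex2 in simp_all)
qed

text \<open>For \<open>a = 4\<close> and \<open>a = 6\<close> the search returns exactly the
  polynomial and its reflection.\<close>

lemma rigid_4_1:
  assumes "20 \<le> m"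
  shows "rigid ((monom 1 1 - 1)\<^sup>2) (((monom 1 1 - 1)\<^sup>2) * denom 4 1 m)"
proof -
  let ?lo = "[1, -1, 1, 0, 0, -1, 0, 0, 0, 0] :: int list" and ?hi = "[1, 0, 0, 0, -1, 0, 0, 0, 0, 0] :: int list"
  have F: "(monom 1 1 - 1)\<^sup>2 * denom 4 1 m = two_ended (m + 5) ?lo ?hi"
    using assms two_ended_denom[of 4 m ?hi ?lo 1]
    by (simp add: numeral_eq_Suc monom_Suc monom_0 one_pCons)
  show ?thesis unfolding F
  proof (rule rigid_two_ended[where K = 10 and s = "1" and b = 4])
    show "completions (map (\<lambda>j. 1 * (\<Sum>i\<leftarrow>[0..<Suc j]. ?lo ! i * ?hi ! (j - i))) [1..<10]) 4 [] [] =
        [([0, 0, 0, 0, -1, 0, 0, 1, -1], [0, 0, 0, 0, 0, -1, 0, 0, 0]), ([0, 0, 0, 0, 0, -1, 0, 0, 0], [0, 0, 0, 0, -1, 0, 0, 1, -1])]"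
      by code_simp
  qed (use assms in simp_all)
qed

lemma rigid_4_3:
  assumes "20 \<le> m"
  shows "rigid ((monom 1 1 - 1)\<^sup>2) (((monom 1 1 - 1)\<^sup>2) * denom 4 3 m)"
proof -
  let ?lo = "[1, 0, 0, -1, 1, -1, 0, 0, 0, 0] :: int list" and ?hi = "[1, 0, 0, 0, -1, 0, 0, 0, 0, 0] :: int list"
  have F: "(monom 1 1 - 1)\<^sup>2 * denom 4 3 m = two_ended (m + 5) ?lo ?hi"
    using assms two_ended_denom[of 4 m ?hi ?lo 3]
    by (simp add: numeral_eq_Suc monom_Suc monom_0 one_pCons)
  show ?thesis unfolding F
  proof (rule rigid_two_ended[where K = 10 and s = "1" and b = 4])
    show "completions (map (\<lambda>j. 1 * (\<Sum>i\<leftarrow>[0..<Suc j]. ?lo ! i * ?hi ! (j - i))) [1..<10]) 4 [] [] =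
        [([0, 0, 0, 0, -1, 1, -1, 0, 0], [0, 0, 0, 0, 0, -1, 0, 0, 0]), ([0, 0, 0, 0, 0, -1, 0, 0, 0], [0, 0, 0, 0, -1, 1, -1, 0, 0])]"
      by code_simp
  qed (use assms in simp_all)
qed

lemma rigid_6_1:
  assumes "30 \<le> m"
  shows "rigid ((monom 1 1 - 1)\<^sup>2) (((monom 1 1 - 1)\<^sup>2) * denom 6 1 m)"
proof -
  let ?lo = "[1, -1, 1, 0, 0, 0, 0, -1, 0, 0, 0, 0, 0, 0] :: int list" and ?hi = "[1, 0, 0, 0, 0, 0, -1, 0, 0, 0, 0, 0, 0, 0] :: int list"
  have F: "(monom 1 1 - 1)\<^sup>2 * denom 6 1 m = two_ended (m + 7) ?lo ?hi"
    using assms two_ended_denom[of 6 m ?hi ?lo 1]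
    by (simp add: numeral_eq_Suc monom_Suc monom_0 one_pCons)
  show ?thesis unfolding F
  proof (rule rigid_two_ended[where K = 14 and s = "1" and b = 4])
    show "completions (map (\<lambda>j. 1 * (\<Sum>i\<leftarrow>[0..<Suc j]. ?lo ! i * ?hi ! (j - i))) [1..<14]) 4 [] [] =
        [([0, 0, 0, 0, 0, 0, -1, 0, 0, 0, 0, 1, -1], [0, 0, 0, 0, 0, 0, 0, -1, 0, 0, 0, 0, 0]), ([0, 0, 0, 0, 0, 0, 0, -1, 0, 0, 0, 0, 0], [0, 0, 0, 0, 0, 0, -1, 0, 0, 0, 0, 1, -1])]"
      by code_simp
  qed (use assms in simp_all)
qed

lemma rigid_6_5:
  assumes "30 \<le> m"
  shows "rigid ((monom 1 1 - 1)\<^sup>2) (((monom 1 1 - 1)\<^sup>2) * denom 6 5 m)"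
proof -
  let ?lo = "[1, 0, 0, 0, 0, -1, 1, -1, 0, 0, 0, 0, 0, 0] :: int list" and ?hi = "[1, 0, 0, 0, 0, 0, -1, 0, 0, 0, 0, 0, 0, 0] :: int list"
  have F: "(monom 1 1 - 1)\<^sup>2 * denom 6 5 m = two_ended (m + 7) ?lo ?hi"
    using assms two_ended_denom[of 6 m ?hi ?lo 5]
    by (simp add: numeral_eq_Suc monom_Suc monom_0 one_pCons)
  show ?thesis unfolding F
  proof (rule rigid_two_ended[where K = 14 and s = "1" and b = 4])
    show "completions (map (\<lambda>j. 1 * (\<Sum>i\<leftarrow>[0..<Suc j]. ?lo ! i * ?hi ! (j - i))) [1..<14]) 4 [] [] =
        [([0, 0, 0, 0, 0, 0, -1, 1, -1, 0, 0, 0, 0], [0, 0, 0, 0, 0, 0, 0, -1, 0, 0, 0, 0, 0]), ([0, 0, 0, 0, 0, 0, 0, -1, 0, 0, 0, 0, 0], [0, 0, 0, 0, 0, 0, -1, 1, -1, 0, 0, 0, 0])]"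
      by code_simp
  qed (use assms in simp_all)
qed

section \<open>The factorisation\<close>

lemma D_set_simps:
  "D_set 2 = {3}" "D_set 3 = {2, 4}" "D_set 4 = {3, 5}" "D_set 6 = {5, 7}"
proof -
  show "D_set 2 = {3}"
  proof (intro equalityI subsetI)
    fix d assume "d \<in> D_set 2"
    then have d: "2 \<le> d" "d dvd 1 \<or> d dvd 3" by (auto simp: D_set_def)
    then have "d \<le> 3" by (auto dest: dvd_imp_le)
    then have "d = 2 \<or> d = 3" using d(1) by presburger
    with d show "d \<in> {3}" by auto
  qed (auto simp: D_set_def)
  show "D_set 3 = {2, 4}"
  proof (intro equalityI subsetI)
    fix d assume "d \<in> D_set 3"
    then have d: "2 \<le> d" "d dvd 2 \<or> d dvd 4" by (auto simp: D_set_def)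
    then have "d \<le> 4" by (auto dest: dvd_imp_le)
    then have "d = 2 \<or> d = 3 \<or> d = 4" using d(1) by presburger
    with d show "d \<in> {2, 4}" by auto
  qed (auto simp: D_set_def)
  show "D_set 4 = {3, 5}"
  proof (intro equalityI subsetI)
    fix d assume "d \<in> D_set 4"
    then have d: "2 \<le> d" "d dvd 3 \<or> d dvd 5" by (auto simp: D_set_def)
    then have "d \<le> 5" by (auto dest: dvd_imp_le)
    then have "d = 2 \<or> d = 3 \<or> d = 4 \<or> d = 5" using d(1) by presburger
    with d show "d \<in> {3, 5}" by auto
  qed (auto simp: D_set_def)
  show "D_set 6 = {5, 7}"
  proof (intro equalityI subsetI)
    fix d assume "d \<in> D_set 6"
    then have d: "2 \<le> d" "d dvd 5 \<or> d dvd 7" by (auto simp: D_set_def)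
    then have "d \<le> 7" by (auto dest: dvd_imp_le)
    then have "d = 2 \<or> d = 3 \<or> d = 4 \<or> d = 5 \<or> d = 6 \<or> d = 7" using d(1) by presburger
    with d show "d \<in> {5, 7}" by auto
  qed (auto simp: D_set_def)
qed

lemma D_set_subset:
  assumes "a \<in> {2, 3, 4, 6}"
  shows "D_set a \<subseteq> {2, 3, 4, 5, 7}"
  using assms by (elim insertE emptyE) (simp_all add: D_set_simps)

lemma cyclotomic_small:
  "cyclotomic 2 = [:1, 1:]" "cyclotomic 3 = [:1, 1, 1:]" "cyclotomic 4 = [:1, 0, 1:]"
  "cyclotomic 5 = [:1, 1, 1, 1, 1:]" "cyclotomic 7 = [:1, 1, 1, 1, 1, 1, 1:]"
proof -
  have primes: "prime (3 :: nat)" "prime (5 :: nat)" "prime (7 :: nat)" by (simp_all add: prime_nat_numeral_eq)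
  show "cyclotomic 2 = [:1, 1:]" "cyclotomic 3 = [:1, 1, 1:]"
    using cyclotomic_prime[OF two_is_prime_nat] cyclotomic_prime[OF primes(1)]
    by (simp_all add: numeral_eq_Suc qnum_Suc' monom_Suc monom_0 one_pCons)
  show "cyclotomic 4 = [:1, 0, 1:]"
    unfolding cyclotomic_4 by (simp add: numeral_eq_Suc monom_Suc monom_0 one_pCons)
  show "cyclotomic 5 = [:1, 1, 1, 1, 1:]" "cyclotomic 7 = [:1, 1, 1, 1, 1, 1, 1:]"
    using cyclotomic_prime[OF primes(2)] cyclotomic_prime[OF primes(3)]
    by (simp_all add: numeral_eq_Suc qnum_Suc' monom_Suc monom_0 one_pCons)
qed

lemma of_int_poly_cyclotomic:
  assumes "d \<in> {2, 3, 4, 5, 7}"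
  shows "of_int_poly (cyclotomic d) = (\<Prod>z\<in>primitive_roots d. [:- z, 1:])"
proof -
  have "d = 4 \<or> prime d" using assms by (auto simp: prime_nat_numeral_eq)
  then show ?thesis
    using prod_primitive_roots_4 prod_primitive_roots_prime[of d] cyclotomic_prime[of d]
    by (elim disjE) (simp_all only: cyclotomic_4)
qed

lemma reflect_cyclotomic:
  assumes "d \<in> {2, 3, 4, 5, 7}"
  shows "reflect_poly (cyclotomic d) = cyclotomic d"
  using assms by (elim insertE emptyE) (simp_all add: cyclotomic_small reflect_poly_def)

text \<open>At 1 a cyclotomic polynomial of prime index \<open>p\<close> has value \<open>p\<close>,
  and that of index 4 has value 2. So the product is at most 3, 4, 15, 35 for \<open>a\<close> = 2,
  3, 4, 6, less than half of \<open>5 * a\<^sup>2\<close>.\<close>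

lemma C_poly_1_bound:
  assumes "a \<in> {2, 3, 4, 6}" "n > 5 * a\<^sup>2"
  shows "0 < poly (C_poly a n) 1" "2 * poly (C_poly a n) 1 \<le> int n"
proof -
  define A where "A = {d. d \<in> D_set a \<and> d dvd n}"
  have C: "poly (C_poly a n) 1 = (\<Prod>d\<in>A. poly (cyclotomic d) 1)"
    by (simp add: C_poly_def A_def poly_prod)
  have sub: "A \<subseteq> D_set a" by (auto simp: A_def)
  have cases: "A = {} \<or> A = {c} \<or> A = {d} \<or> A = {c, d}" if "A \<subseteq> {c, d}" for c d
    using that by (cases "c \<in> A"; cases "d \<in> A") blast+
  have "0 < poly (C_poly a n) 1 \<and> 2 * poly (C_poly a n) 1 \<le> int n"
    using assms(1)
  proof (elim insertE emptyE)
    assume a: "a = 2"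
    have n: "20 < n" using assms(2) by (simp add: a)
    have "A \<subseteq> {3, 3}" using sub by (simp add: a D_set_simps)
    from cases[OF this] show ?thesis
      unfolding C by (elim disjE) (use n in \<open>simp_all add: cyclotomic_small\<close>)
  next
    assume a: "a = 3"
    have n: "45 < n" using assms(2) by (simp add: a)
    have "A \<subseteq> {2, 4}" using sub by (simp add: a D_set_simps)
    from cases[OF this] show ?thesis
      unfolding C by (elim disjE) (use n in \<open>simp_all add: cyclotomic_small\<close>)
  next
    assume a: "a = 4"
    have n: "80 < n" using assms(2) by (simp add: a)
    have "A \<subseteq> {3, 5}" using sub by (simp add: a D_set_simps)
    from cases[OF this] show ?thesis
      unfolding C by (elim disjE) (use n in \<open>simp_all add: cyclotomic_small\<close>)
  next
    assume a: "a = 6"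
    have n: "180 < n" using assms(2) by (simp add: a)
    have "A \<subseteq> {5, 7}" using sub by (simp add: a D_set_simps)
    from cases[OF this] show ?thesis
      unfolding C by (elim disjE) (use n in \<open>simp_all add: cyclotomic_small\<close>)
  qed
  then show "0 < poly (C_poly a n) 1" "2 * poly (C_poly a n) 1 \<le> int n" by auto
qed

lemma rigid_denom:
  assumes "a \<in> {2, 3, 4, 6}" "b = 1 \<or> b = a - 1" "5 * a \<le> m"
  obtains W where "reflect_poly W \<in> {W, - W}" "coeff W 0 \<noteq> 0" "rigid W (W * denom a b m)"
proof -
  let ?X = "monom 1 1 - 1 :: int poly"
  have X: "?X = [:- 1, 1:]" by (simp add: monom_Suc monom_0 one_pCons)
  have "reflect_poly ?X = - ?X" unfolding X by (simp add: reflect_poly_def)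
  moreover have "coeff ?X 0 \<noteq> 0" unfolding X by simp
  moreover have "reflect_poly (?X\<^sup>2) = ?X\<^sup>2"
    unfolding reflect_poly_power calculation(1) by (simp only: power2_minus)
  moreover have "coeff (?X\<^sup>2) 0 \<noteq> 0" unfolding X by (simp add: power2_eq_square)
  moreover have "rigid ?X (?X * denom a b m) \<or> rigid (?X\<^sup>2) (?X\<^sup>2 * denom a b m)"
    using assms(1)
  proof (elim insertE emptyE)
    assume "a = 2"
    then show ?thesis using rigid_2_1[of m] assms(2,3) by auto
  next
    assume "a = 3"
    then show ?thesis using rigid_3_1[of m] rigid_3_2[of m] assms(2,3) by auto
  next
    assume "a = 4"
    then show ?thesis using rigid_4_1[of m] rigid_4_3[of m] assms(2,3) by auto
  next
    assume "a = 6"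
    then show ?thesis using rigid_6_1[of m] rigid_6_5[of m] assms(2,3) by auto
  qed
  ultimately show thesis using that[of ?X] that[of "?X\<^sup>2"] by blast
qed

lemma denom_factorization:
  assumes a: "a \<in> {2, 3, 4, 6}" and b: "b = 1 \<or> b = a - 1" and m: "5 * a \<le> m"
    and n: "n = a * m + b" and large: "n > 5 * a\<^sup>2"
  shows "\<exists>E :: int poly. denom a b m = C_poly a n * E
    \<and> irreducible (of_int_poly E :: rat poly)
    \<and> (\<forall>z :: complex. poly (of_int_poly E) z = 0 \<longrightarrow> \<not> (\<exists>k\<ge>1. z ^ k = 1))
    \<and> (of_int (poly E 1) :: rat) = of_nat n / of_int (poly (C_poly a n) 1)
    \<and> (of_nat n :: rat) / of_int (poly (C_poly a n) 1) \<ge> 2"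
proof -
  define S where "S = denom a b m"
  define C where "C = C_poly a n"
  define A where "A = {d. d \<in> D_set a \<and> d dvd n}"
  define Z where "Z = (\<Union>d\<in>A. primitive_roots d)"
  have a2: "2 \<le> a" and m2: "a + 2 < m" and m0: "0 < m" and b0: "0 < b" and n0: "0 < n"
    using a b m n by auto
  have A_small: "A \<subseteq> {2, 3, 4, 5, 7}" using D_set_subset[OF a] by (auto simp: A_def)
  then have finA: "finite A" by (rule finite_subset) simp
  have finZ: "finite Z" using finA by (auto simp: Z_def)
  have C_eq: "C = (\<Prod>d\<in>A. cyclotomic d)" by (simp add: C_def C_poly_def A_def)
  have C_complex: "(of_int_poly C :: complex poly) = (\<Prod>z\<in>Z. [:- z, 1:])"
  proof -
    have "(of_int_poly C :: complex poly) = (\<Prod>d\<in>A. \<Prod>z\<in>primitive_roots d. [:- z, 1:])"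
      unfolding C_eq of_int_poly_hom.hom_prod
      using A_small by (intro prod.cong refl of_int_poly_cyclotomic) auto
    also have "\<dots> = (\<Prod>z\<in>Z. [:- z, 1:])"
      unfolding Z_def using finA disjoint_primitive_roots by (subst prod.UNION_disjoint) auto
    finally show ?thesis .
  qed
  have C_monic: "lead_coeff C = 1"
    using monic_linear_prod[of Z] unfolding C_complex[symmetric] by simp
  have C_root: "poly (of_int_poly C) z = 0 \<longleftrightarrow> z \<in> Z" for z :: complex
    unfolding C_complex using finZ by (auto simp: poly_prod)
  \<comment> \<open>This matches the roots of \<open>C\<close> with those roots of unity at which
    \<open>denom_roots_of_unity_iff\<close> makes \<open>S\<close> vanish.\<close>
  have Z_iff: "z \<in> Z \<longleftrightarrow> z \<noteq> 1 \<and> (z ^ (a - 1) = 1 \<or> z ^ (a + 1) = 1) \<and> z ^ n = 1" for z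
  proof
    assume "z \<in> Z"
    then obtain d where "d \<in> A" and z: "z \<in> primitive_roots d" unfolding Z_def by blast
    then have d: "2 \<le> d" "d dvd a - 1 \<or> d dvd a + 1" "d dvd n" by (simp_all add: A_def D_set_def)
    have "z \<noteq> 1" using primitive_roots_power_eq_1_iff[OF z, of 1] d(1) by (intro notI) simp
    then show "z \<noteq> 1 \<and> (z ^ (a - 1) = 1 \<or> z ^ (a + 1) = 1) \<and> z ^ n = 1"
      unfolding primitive_roots_power_eq_1_iff[OF z] using d by blast
  next
    assume z: "z \<noteq> 1 \<and> (z ^ (a - 1) = 1 \<or> z ^ (a + 1) = 1) \<and> z ^ n = 1"
    obtain d where d: "d dvd n" "z \<in> primitive_roots d"
      using primitive_roots_cover[of z n] z n0 by blast
    have "d \<noteq> 0" using d(1) n0 by (intro notI) simp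
    moreover have "d \<noteq> 1" using d(2) z by (intro notI) (simp add: primitive_roots_1)
    ultimately have "2 \<le> d" by simp
    moreover have "d dvd a - 1 \<or> d dvd a + 1"
      using z unfolding primitive_roots_power_eq_1_iff[OF d(2)] by blast
    ultimately have "d \<in> A" using d(1) by (simp add: A_def D_set_def)
    then show "z \<in> Z" using d(2) unfolding Z_def by blast
  qed
  have "C dvd S"
  proof (rule of_int_poly_dvd_monic[OF _ C_monic])
    show "(of_int_poly C :: complex poly) dvd of_int_poly S"
      unfolding C_complex
    proof (rule prod_linear_dvd[OF finZ])
      fix z assume "z \<in> Z"
      then show "poly (of_int_poly S) z = 0"
        using denom_roots_of_unity_iff[of z a b m] Z_iff[of z] b a2 by (simp add: S_def n)
    qed
  qed
  then obtain E where E: "S = C * E" by (elim dvdE)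
  have S_root: "poly (of_int_poly S) z = poly (of_int_poly C) z * poly (of_int_poly E) z" for z :: complex
    unfolding E by (simp add: of_int_poly_hom.hom_mult)
  have S1: "poly S 1 = int n"
    by (simp add: S_def denom_def poly_qnum_1 poly_monom n)
  then have E1: "poly C 1 * poly E 1 = int n" unfolding E by simp
  have S0: "poly S 0 = 1"
    using b0 by (simp add: S_def denom_def poly_qnum_0 poly_monom)
  have C1: "0 < poly C 1" "2 * poly C 1 \<le> int n"
    using C_poly_1_bound[OF a large] by (simp_all add: C_def)
  have not_root_1: "poly (of_int_poly E :: complex poly) 1 \<noteq> 0"
    using E1 n0 of_int_hom.poly_map_poly[of E 1, where 'a = complex] by auto
  have no_unity: "\<not> (\<exists>k\<ge>1. z ^ k = 1)" if z: "poly (of_int_poly E) z = 0" for z :: complex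
  proof
    assume "\<exists>k\<ge>1. z ^ k = 1"
    then obtain k where k: "k \<ge> 1" "z ^ k = 1" by auto
    have z1: "z \<noteq> 1" using z not_root_1 by auto
    have Sz: "poly (of_int_poly S) z = 0" using S_root z by simp
    \<comment> \<open>On the unit circle inversion is conjugation, and \<open>S\<close> has real
      coefficients, so \<open>1 / z\<close> is a root of \<open>S\<close> as well.\<close>
    have "norm z = 1" using k norm_root_of_unity[of z k] by simp
    then have "inverse z = cnj z" by (simp add: inverse_complex_def complex_eq_iff complex_norm cmod_power2[symmetric])
    moreover have "cnj (poly (of_int_poly S) z) = poly (of_int_poly S) (cnj z)"
      by (rule poly_cnj_real) simp
    ultimately have "poly (of_int_poly S) (inverse z) = 0" using Sz by simp
    then have unity: "z ^ (a - 1) = 1 \<or> z ^ (a + 1) = 1"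
      using denom_root_pair[of a b m z] Sz b a2 m0 z1 by (auto simp: S_def)
    then have "z ^ n = 1"
      using denom_roots_of_unity_iff[OF z1 unity b a2, of m] Sz by (simp add: S_def n)
    \<comment> \<open>As a common root of \<open>C\<close> and \<open>E\<close>, \<open>z\<close>
      would be a multiple root of \<open>S\<close>.\<close>
    then have "poly (of_int_poly C) z = 0" using C_root Z_iff z1 unity by simp
    then have "poly (of_int_poly (pderiv S)) z = 0"
      using z unfolding E pderiv_mult of_int_poly_hom.hom_add of_int_poly_hom.hom_mult by simp
    then show False
      using denom_simple_root[OF z1 unity b a2 m2] Sz by (simp add: S_def)
  qed
  have pair: "poly (of_int_poly E) (inverse z) \<noteq> 0" if z: "poly (of_int_poly E) z = 0" for z :: complex
  proof
    assume "poly (of_int_poly E) (inverse z) = 0"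
    then have "z = 1 \<or> z ^ (a - 1) = 1 \<or> z ^ (a + 1) = 1"
      using denom_root_pair[of a b m z] S_root z b a2 m0 by (simp add: S_def)
    moreover have "1 \<le> a - 1" "1 \<le> a + 1" using a2 by auto
    ultimately have "\<exists>k\<ge>1. z ^ k = 1" by (metis order_refl power_one)
    with no_unity[OF z] show False by (rule notE)
  qed
  obtain W0 where W0: "reflect_poly W0 \<in> {W0, - W0}" "coeff W0 0 \<noteq> 0" "rigid W0 (W0 * S)"
    using rigid_denom[OF a b m] unfolding S_def by blast
  have reflC: "reflect_poly C = C"
    unfolding C_eq reflect_poly_prod using A_small by (intro prod.cong refl reflect_cyclotomic) auto
  \<comment> \<open>Rigidity is known for \<open>W0 * S\<close>; absorbing the reciprocal factor
    \<open>C\<close> into the multiplier makes it a statement about \<open>E\<close>.\<close>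
  have WE: "W0 * C * E = W0 * S" by (simp add: E mult_ac)
  have degE: "degree E > 0"
  proof (rule ccontr)
    assume "\<not> degree E > 0"
    then obtain c where c: "E = [:c:]" by (auto dest: degree0_coeffs)
    \<comment> \<open>A constant \<open>E\<close> would divide \<open>S(0) = 1\<close>, hence be at
      most 1, while \<open>n = C(1) * c\<close> is at least \<open>2 * C(1)\<close>.\<close>
    have "c dvd 1" using S0 unfolding E c by (simp add: dvd_def mult.commute) (metis mult.commute)
    then have "c \<le> 1" by (auto dest: zdvd_imp_le)
    then have "poly C 1 * c \<le> poly C 1 * 1" using C1(1) by (intro mult_left_mono) auto
    moreover have "poly C 1 * c = int n" using E1 by (simp add: c)
    ultimately show False using C1 n0 by linarith
  qed
  have "irreducible\<^sub>d E"
  proof (rule irreducible_if_rigid[where W = "W0 * C"])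
    show "reflect_poly (W0 * C) \<in> {W0 * C, - (W0 * C)}"
      using W0(1) by (auto simp: reflect_poly_mult reflC)
    have "coeff (W0 * S) 0 = coeff W0 0 * poly S 0" by (simp add: coeff_mult_0 poly_0_coeff_0)
    then show "coeff (W0 * C * E) 0 \<noteq> 0" unfolding WE using W0(2) S0 by simp
    fix H assume "W0 * C dvd H" "degree H = degree (W0 * C * E)"
      "H * reflect_poly H = W0 * C * E * reflect_poly (W0 * C * E)"
    then show "H \<in> {W0 * C * E, - (W0 * C * E), reflect_poly (W0 * C * E), - reflect_poly (W0 * C * E)}"
      using W0(3) dvd_mult_left[of W0 C H] unfolding WE rigid_def by blast
  qed (use degE pair in auto)
  then have "irreducible (of_int_poly E :: rat poly)" by (rule irreducible_of_int_poly_rat)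
  moreover have "(of_int (poly E 1) :: rat) = of_nat n / of_int (poly C 1)"
  proof -
    have "(of_int (poly C 1 * poly E 1) :: rat) = of_nat n" unfolding E1 by simp
    then show ?thesis using C1(1) by (simp add: field_simps)
  qed
  moreover have "(of_nat n :: rat) / of_int (poly C 1) \<ge> 2"
  proof -
    have "(of_int (2 * poly C 1) :: rat) \<le> of_int (int n)" using C1(2) by (simp only: of_int_le_iff)
    then show ?thesis using C1(1) by (simp add: le_divide_eq)
  qed
  ultimately show ?thesis
    unfolding S_def[symmetric] C_def[symmetric]
    by (intro exI[of _ E] conjI allI impI no_unity) (simp_all only: E)
qed

theorem theorem1p7:
  fixes a n :: nat
  assumes "a \<in> {2, 3, 4, 6}"
    and "n > 5 * a\<^sup>2"
    and "coprime n a"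
  shows "\<exists>E :: int poly.
      q_denominator (of_nat a / of_nat n) = C_poly a n * E
    \<and> irreducible (map_poly of_int E :: rat poly)
    \<and> (\<forall>z :: complex. poly (map_poly of_int E) z = 0 \<longrightarrow> \<not> (\<exists>m\<ge>1. z ^ m = 1))
    \<and> (of_int (poly E 1) :: rat) = of_nat n / of_int (poly (C_poly a n) 1)
    \<and> (of_nat n :: rat) / of_int (poly (C_poly a n) 1) \<ge> 2"
proof -
  define m where "m = n div a"
  define b where "b = n mod a"
  have n: "n = a * m + b" by (simp add: m_def b_def)
  have cop: "\<not> p dvd n" if "p dvd a" "p \<noteq> 1" for p
    using assms(3) that coprime_common_divisor_nat[of n a p] by auto
  \<comment> \<open>For 2, 3, 4 and 6 the only residues prime to \<open>a\<close> are 1 and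
    -1.\<close>
  have b: "b = 1 \<or> b = a - 1"
    using assms(1)
  proof (elim insertE emptyE)
    assume a: "a = 2"
    then show ?thesis using cop[of 2] unfolding b_def a by presburger
  next
    assume a: "a = 3"
    then show ?thesis using cop[of 3] unfolding b_def a by presburger
  next
    assume a: "a = 4"
    then show ?thesis using cop[of 2] unfolding b_def a by presburger
  next
    assume a: "a = 6"
    then show ?thesis using cop[of 2] cop[of 3] unfolding b_def a by presburger
  qed
  have m: "5 * a \<le> m"
  proof -
    have "b < a" using assms(1) by (auto simp: b_def)
    moreover have "5 * a\<^sup>2 < a * m + b" using assms(2) by (simp only: n[symmetric])
    moreover have "a * (5 * a) = 5 * a\<^sup>2" "a * (m + 1) = a * m + a" by (simp_all add: power2_eq_square)
    ultimately have "a * (5 * a) < a * (m + 1)" by linarith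
    then have "5 * a < m + 1" by (simp only: mult_less_cancel1)
    then show ?thesis by simp
  qed
  have a2: "2 \<le> a" using assms(1) by auto
  then have m0: "0 < m" using m by linarith
  have "q_denominator (of_nat a / of_nat n) = denom a b m"
  proof (cases "b = 1")
    case True
    then show ?thesis using q_denominator_plus_1[OF a2 m0] unfolding n by simp
  next
    case False
    \<comment> \<open>For \<open>a = 2\<close> both residues coincide with 1, so this case starts at
      \<open>a = 3\<close>.\<close>
    then have "b = a - 1" "3 \<le> a" using b a2 by auto
    then show ?thesis using q_denominator_minus_1[OF _ m0] unfolding n by simp
  qed
  then show ?thesis using denom_factorization[OF assms(1) b m n assms(2)] by (simp only:)
qed

end
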